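(* Let $(A,\ast,\circ)$ be an anti-pre-Poisson algebra and $(V,l_\ast,r_\ast,l_\circ,r_\circ)$ a representation of it, with dual representation $(V^*,l_\ast^*+r_\ast^*,-r_\ast^*,r_\circ^*-l_\circ^*,r_\circ^* )$. Let $\hat A=A\ltimes V^*$ be the semi-direct product anti-pre-Poisson algebra, and let $T:V\to A$ be a linear map, identified with an element of $\hat A\otimes\hat A$ through $\mathrm{Hom}(V,A)\simeq A\otimes V^*\subseteq\hat A\otimes\hat A$. Then $r=T-\tau(T)$ is a skew-symmetric solution of the APP-YBE in the anti-pre-Poisson algebra $\hat A$ if and only if $T$ is an $\mathcal O$-operator on $(A,\ast,\circ)$ associated to $(V,l_\ast,r_\ast,l_\circ,r_\circ)$.
   Context: Throughout, $k$ is a field and all vector spaces and algebras are finite-dimensional over $k$. Algebras. An anti-Zinbiel algebra $(A,\ast)$ is a vector space with a bilinear operation such that $x\ast(y\ast z)=-(x\ast y+y\ast x)\ast z=-(y\ast z+z\ast y)\ast x=z\ast(y\ast x)$ and $z\ast(x\ast y)=x\ast(z\ast y)$ for all $x,y,z$. An anti-pre-Lie algebra $(A,\circ)$ is a vector space with a bilinear operation such that, with $[x,y]=x\circ y-y\circ x$, $x\circ(y\circ z)-y\circ(x\circ z)=[y,x]\circ z$ and $[x,y]\circ z+[y,z]\circ x+[z,x]\circ y=0$. An anti-pre-Poisson algebra $(A,\ast,\circ)$ consists of an anti-Zinbiel algebra $(A,\ast)$ and an anti-pre-Lie algebra $(A,\circ)$ with $(x\circ y-y\circ x)\ast z=y\ast(x\circ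 z)-x\circ(y\ast z)$, $(x\ast y+y\ast x)\circ z=-x\ast(y\circ z)-y\ast(x\circ z)$, and $z\circ(x\ast y+y\ast x)+x\ast(y\circ z)+y\ast(x\circ z)=x\ast(z\circ y)+y\ast(z\circ x)$. Put $x\star y=x\ast y+y\ast x$. Representation. $(V,l_\ast,r_\ast,l_\circ,r_\circ)$, with linear maps $A\to\mathrm{End}(V)$, is a representation of $(A,\ast,\circ)$ if, with $l_\star=l_\ast+r_\ast$, for all $x,y\in A$: anti-Zinbiel part: $l_\ast(x)l_\ast(y)=-l_\ast(x\star y)=-r_\ast(x)l_\star(y)=r_\ast(y\ast x)$; $l_\ast(x)r_\ast(y)=-r_\ast(y)l_\star(x)=-r_\ast(x)l_\star(y)=l_\ast(y)r_\ast(x)$; $r_\ast(x\ast y)=l_\ast(x)r_\ast(y)$; $l_\ast(y)l_\ast(x)=l_\ast(x)l_\ast(y)$; anti-pre-Lie part: $l_\circ(y\circ x)-l_\circ(x\circ y)=l_\circ(x)l_\circ(y)-l_\circ(y)l_\circ(x)$; $r_\circ(x\circ y)=l_\circ(x)r_\circ(y)+r_\circ(y)l_\circ(x)-r_\circ(y)r_\circ(x)$; $l_\circ(y\circ x)-l_\circ(x\circ y)=r_\circ(x)l_\circ(y)-r_\circ(y)l_\circ(x)-r_\circ(x)r_\circ(y)+r_\circ(y)r_\circ(x)$; compatibility: $l_\ast([x,y])=l_\ast(y)l_\circ(x)-l_\circ(x)l_\ast(y)$; $l_\circ(x\star y)=-l_\ast(x)l_\circ(y)-l_\ast(y)l_\circ(x)$;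 $r_\ast(x)(l_\circ(y)-r_\circ(y))=r_\circ(y\ast x)-l_\ast(y)r_\circ(x)$; $r_\circ(x)(l_\ast(y)+r_\ast(y))=-r_\ast(y\circ x)-l_\ast(y)r_\circ(x)$; $r_\ast(x)(l_\circ(y)-r_\circ(y))=r_\ast(y\circ x)-l_\circ(y)r_\ast(x)$; $r_\circ(x\star y)+l_\ast(x)l_\circ(y)+l_\ast(y)l_\circ(x)=l_\ast(x)r_\circ(y)+l_\ast(y)r_\circ(x)$; $l_\circ(x)(l_\ast(y)+r_\ast(y))+r_\ast(y\circ x)+l_\ast(y)r_\circ(x)=l_\ast(y)l_\circ(x)+r_\ast(x\circ y)$. For $f:A\to\mathrm{End}(V)$, $f^*:A\to\mathrm{End}(V^* )$ is given by $\langle f^*(x)u^*,v\rangle=-\langle u^*,f(x)v\rangle$. Semi-direct product $A\ltimes V^*$: the space $A\oplus V^*$ with $(x+u)\ast(y+v)=x\ast y+(l_\ast^*+r_\ast^* )(x)v-r_\ast^*(y)u$ and $(x+u)\circ(y+v)=x\circ y+(r_\circ^*-l_\circ^* )(x)v+r_\circ^*(y)u$, for $x,y\in A$, $u,v\in V^*$; it is an anti-pre-Poisson algebra. Identification: for a basis $\{v_i\}$ of $V$ with dual basis $\{v_i^*\}$, $T$ corresponds to $\sum_iT(v_i)\otimes v_i^*$. $\tau(x\otimes y)=y\otimes x$. $\mathcal O$-operator associated to $(V,l_\ast,r_\ast,l_\circ,r_\circ)$: a linear map $T:V\to A$ with $T(u)\ast T(v)=T(l_\ast(T(u))v+r_\ast(T(v))u)$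 and $T(u)\circ T(v)=T(l_\circ(T(u))v+r_\circ(T(v))u)$ for all $u,v\in V$. APP-YBE in an anti-pre-Poisson algebra $(B,\ast,\circ)$ for $r=\sum_ia_i\otimes b_i\in B\otimes B$: both $D(r)=\sum_{i,j}\big(a_i\otimes b_i\ast a_j\otimes b_j-a_i\ast a_j\otimes b_i\otimes b_j+a_i\otimes a_j\otimes b_i\star b_j\big)=0$ and $S(r)=\sum_{i,j}\big(a_i\circ a_j\otimes b_i\otimes b_j+a_i\otimes b_i\circ a_j\otimes b_j-a_i\otimes a_j\otimes[b_i,b_j]\big)=0$. Skew-symmetric means $\tau(r)=-r$. *)

theory Defs
  imports
    Complex_Main
    "HOL-Algebra.Free_Abelian_Groups"
    "HOL-Library.Function_Algebras"
    "HOL-Library.Product_Plus"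
begin

section \<open>Anti-pre-Poisson algebras\<close>

text \<open>An algebra lives on a finite-dimensional subspace \<open>B\<close> of the ambient type. The carrier is
  needed for the semi-direct product, whose second component is the space of linear functionals
  inside a full function type.\<close>

locale bilinear_algebra = vector_space scale
  for scale :: "'k::field \<Rightarrow> 'b::ab_group_add \<Rightarrow> 'b" +
  fixes B :: "'b set" and mult :: "'b \<Rightarrow> 'b \<Rightarrow> 'b"
  assumes subspace_carrier: "subspace B"
    and finite_dimensional: "\<exists>S. finite S \<and> span S = B"
    and mult_closed: "x \<in> B \<Longrightarrow> y \<in> B \<Longrightarrow> mult x y \<in> B"
    and mult_add_left: "x \<in> B \<Longrightarrow> x' \<in> B \<Longrightarrow> y \<in> B \<Longrightarrow> mult (x + x') y = mult x y + mult x' y"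
    and mult_add_right: "x \<in> B \<Longrightarrow> y \<in> B \<Longrightarrow> y' \<in> B \<Longrightarrow> mult x (y + y') = mult x y + mult x y'"
    and mult_scale_left: "x \<in> B \<Longrightarrow> y \<in> B \<Longrightarrow> mult (scale c x) y = scale c (mult x y)"
    and mult_scale_right: "x \<in> B \<Longrightarrow> y \<in> B \<Longrightarrow> mult x (scale c y) = scale c (mult x y)"

locale anti_Zinbiel_algebra = bilinear_algebra scale B ast
  for scale :: "'k::field \<Rightarrow> 'b::ab_group_add \<Rightarrow> 'b" and B
    and ast :: "'b \<Rightarrow> 'b \<Rightarrow> 'b" (infixl "\<ast>" 70) +
  assumes anti_Zinbiel1: "\<lbrakk>x \<in> B; y \<in> B; z \<in> B\<rbrakk> \<Longrightarrow> x \<ast> (y \<ast> z) = - ((x \<ast> y + y \<ast> x) \<ast> z)"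
    and anti_Zinbiel2: "\<lbrakk>x \<in> B; y \<in> B; z \<in> B\<rbrakk> \<Longrightarrow> x \<ast> (y \<ast> z) = - ((z \<ast> y + y \<ast> z) \<ast> x)"
    and anti_Zinbiel3: "\<lbrakk>x \<in> B; y \<in> B; z \<in> B\<rbrakk> \<Longrightarrow> x \<ast> (y \<ast> z) = z \<ast> (y \<ast> x)"
    and anti_Zinbiel4: "\<lbrakk>x \<in> B; y \<in> B; z \<in> B\<rbrakk> \<Longrightarrow> z \<ast> (x \<ast> y) = x \<ast> (z \<ast> y)"

locale anti_pre_Lie_algebra = bilinear_algebra scale B circ
  for scale :: "'k::field \<Rightarrow> 'b::ab_group_add \<Rightarrow> 'b" and B
    and circ :: "'b \<Rightarrow> 'b \<Rightarrow> 'b" (infixl "\<bullet>" 70) +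
  assumes anti_pre_Lie1: "\<lbrakk>x \<in> B; y \<in> B; z \<in> B\<rbrakk> \<Longrightarrow>
      x \<bullet> (y \<bullet> z) - y \<bullet> (x \<bullet> z) = (y \<bullet> x - x \<bullet> y) \<bullet> z"
    and anti_pre_Lie2: "\<lbrakk>x \<in> B; y \<in> B; z \<in> B\<rbrakk> \<Longrightarrow>
      (x \<bullet> y - y \<bullet> x) \<bullet> z + (y \<bullet> z - z \<bullet> y) \<bullet> x + (z \<bullet> x - x \<bullet> z) \<bullet> y = 0"

locale anti_pre_Poisson_algebra =
  anti_Zinbiel_algebra scale B ast + anti_pre_Lie_algebra scale B circ
  for scale :: "'k::field \<Rightarrow> 'b::ab_group_add \<Rightarrow> 'b" and B
    and ast :: "'b \<Rightarrow> 'b \<Rightarrow> 'b" (infixl "\<ast>" 70)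
    and circ :: "'b \<Rightarrow> 'b \<Rightarrow> 'b" (infixl "\<bullet>" 70) +
  assumes compat1: "\<lbrakk>x \<in> B; y \<in> B; z \<in> B\<rbrakk> \<Longrightarrow>
      (x \<bullet> y - y \<bullet> x) \<ast> z = y \<ast> (x \<bullet> z) - x \<bullet> (y \<ast> z)"
    and compat2: "\<lbrakk>x \<in> B; y \<in> B; z \<in> B\<rbrakk> \<Longrightarrow>
      (x \<ast> y + y \<ast> x) \<bullet> z = - (x \<ast> (y \<bullet> z)) - y \<ast> (x \<bullet> z)"
    and compat3: "\<lbrakk>x \<in> B; y \<in> B; z \<in> B\<rbrakk> \<Longrightarrow>
      z \<bullet> (x \<ast> y + y \<ast> x) + x \<ast> (y \<bullet> z) + y \<ast> (x \<bullet> z) = x \<ast> (z \<bullet> y) + y \<ast> (z \<bullet> x)"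


section \<open>Representations\<close>

text \<open>Linear maps \<open>A \<rightarrow> End(V)\<close>, written as curried functions.\<close>

definition linear_to_End ::
  "('k::field \<Rightarrow> 'a::ab_group_add \<Rightarrow> 'a) \<Rightarrow> ('k \<Rightarrow> 'v::ab_group_add \<Rightarrow> 'v) \<Rightarrow> ('a \<Rightarrow> 'v \<Rightarrow> 'v) \<Rightarrow> bool"
  where "linear_to_End sA sV f \<longleftrightarrow>
    (\<forall>x. Vector_Spaces.linear sV sV (f x)) \<and> (\<forall>v. Vector_Spaces.linear sA sV (\<lambda>x. f x v))"

text \<open>\<open>la\<close>, \<open>ra\<close>, \<open>lc\<close>, \<open>rc\<close> are the left and right actions for the two operations.\<close>

locale anti_pre_Poisson_representation =
  anti_pre_Poisson_algebra sA UNIV ast circ + V: finite_dimensional_vector_space sV Basis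
  for sA :: "'k::field \<Rightarrow> 'a::ab_group_add \<Rightarrow> 'a"
    and ast :: "'a \<Rightarrow> 'a \<Rightarrow> 'a" (infixl "\<ast>" 70)
    and circ :: "'a \<Rightarrow> 'a \<Rightarrow> 'a" (infixl "\<bullet>" 70)
    and sV :: "'k \<Rightarrow> 'v::ab_group_add \<Rightarrow> 'v"
    and Basis :: "'v set" +
  fixes la ra lc rc :: "'a \<Rightarrow> 'v \<Rightarrow> 'v"
  assumes linear_actions: "linear_to_End sA sV la" "linear_to_End sA sV ra"
      "linear_to_End sA sV lc" "linear_to_End sA sV rc"
    and rep_Zinbiel1: "la x (la y v) = - la (x \<ast> y + y \<ast> x) v"
    and rep_Zinbiel2: "la x (la y v) = - ra x (la y v + ra y v)"
    and rep_Zinbiel3: "la x (la y v) = ra (y \<ast> x) v"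
    and rep_Zinbiel4: "la x (ra y v) = - ra y (la x v + ra x v)"
    and rep_Zinbiel5: "la x (ra y v) = - ra x (la y v + ra y v)"
    and rep_Zinbiel6: "la x (ra y v) = la y (ra x v)"
    and rep_Zinbiel7: "ra (x \<ast> y) v = la x (ra y v)"
    and rep_Zinbiel8: "la y (la x v) = la x (la y v)"
    and rep_Lie1: "lc (y \<bullet> x) v - lc (x \<bullet> y) v = lc x (lc y v) - lc y (lc x v)"
    and rep_Lie2: "rc (x \<bullet> y) v = lc x (rc y v) + rc y (lc x v) - rc y (rc x v)"
    and rep_Lie3: "lc (y \<bullet> x) v - lc (x \<bullet> y) v
        = rc x (lc y v) - rc y (lc x v) - rc x (rc y v) + rc y (rc x v)"
    and rep_compat1: "la (x \<bullet> y - y \<bullet> x) v = la y (lc x v) - lc x (la y v)"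
    and rep_compat2: "lc (x \<ast> y + y \<ast> x) v = - la x (lc y v) - la y (lc x v)"
    and rep_compat3: "ra x (lc y v - rc y v) = rc (y \<ast> x) v - la y (rc x v)"
    and rep_compat4: "rc x (la y v + ra y v) = - ra (y \<bullet> x) v - la y (rc x v)"
    and rep_compat5: "ra x (lc y v - rc y v) = ra (y \<bullet> x) v - lc y (ra x v)"
    and rep_compat6: "rc (x \<ast> y + y \<ast> x) v + la x (lc y v) + la y (lc x v)
        = la x (rc y v) + la y (rc x v)"
    and rep_compat7: "lc x (la y v + ra y v) + ra (y \<bullet> x) v + la y (rc x v)
        = la y (lc x v) + ra (x \<bullet> y) v"

definition O_operator ::
  "('k::field \<Rightarrow> 'a::ab_group_add \<Rightarrow> 'a) \<Rightarrow> ('a \<Rightarrow> 'a \<Rightarrow> 'a) \<Rightarrow> ('a \<Rightarrow> 'a \<Rightarrow> 'a) \<Rightarrow>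
   ('k \<Rightarrow> 'v::ab_group_add \<Rightarrow> 'v) \<Rightarrow> ('a \<Rightarrow> 'v \<Rightarrow> 'v) \<Rightarrow> ('a \<Rightarrow> 'v \<Rightarrow> 'v) \<Rightarrow>
   ('a \<Rightarrow> 'v \<Rightarrow> 'v) \<Rightarrow> ('a \<Rightarrow> 'v \<Rightarrow> 'v) \<Rightarrow> ('v \<Rightarrow> 'a) \<Rightarrow> bool"
  where "O_operator sA ast circ sV la ra lc rc T \<longleftrightarrow>
    Vector_Spaces.linear sV sA T \<and>
    (\<forall>u v. ast (T u) (T v) = T (la (T u) v + ra (T v) u)) \<and>
    (\<forall>u v. circ (T u) (T v) = T (lc (T u) v + rc (T v) u))"


section \<open>Dual space and semi-direct product\<close>

definition dual_space :: "('k::field \<Rightarrow> 'v::ab_group_add \<Rightarrow> 'v) \<Rightarrow> ('v \<Rightarrow> 'k) set"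
  where "dual_space sV = {\<phi>. Vector_Spaces.linear sV (*) \<phi>}"

definition dual_action :: "('a \<Rightarrow> 'v \<Rightarrow> 'v) \<Rightarrow> 'a \<Rightarrow> ('v \<Rightarrow> 'k::field) \<Rightarrow> ('v \<Rightarrow> 'k)"
  where "dual_action f x \<phi> = (\<lambda>v. - \<phi> (f x v))"

text \<open>The dual basis element of \<open>b\<close> is the \<open>b\<close>-coordinate with respect to \<open>Basis\<close>.\<close>

definition dual_basis :: "('k::field \<Rightarrow> 'v::ab_group_add \<Rightarrow> 'v) \<Rightarrow> 'v set \<Rightarrow> 'v \<Rightarrow> ('v \<Rightarrow> 'k)"
  where "dual_basis sV Basis b = (\<lambda>v. module.representation sV Basis v b)"

definition semidirect_op ::
  "('a \<Rightarrow> 'a \<Rightarrow> 'a) \<Rightarrow> ('a \<Rightarrow> 'w \<Rightarrow> 'w) \<Rightarrow> ('a \<Rightarrow> 'w \<Rightarrow> 'w) \<Rightarrow> 'a \<times> 'w \<Rightarrow> 'a \<times> 'w \<Rightarrow> 'a \<times> 'w::plus"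
  where "semidirect_op opr l r = (\<lambda>(x, u) (y, v). (opr x y, l x v + r y u))"

definition hat_scale ::
  "('k::field \<Rightarrow> 'a \<Rightarrow> 'a) \<Rightarrow> 'k \<Rightarrow> 'a \<times> ('v \<Rightarrow> 'k) \<Rightarrow> 'a \<times> ('v \<Rightarrow> 'k)"
  where "hat_scale sA c = (\<lambda>(x, \<phi>). (sA c x, \<lambda>v. c * \<phi> v))"

definition hat_carrier :: "('k::field \<Rightarrow> 'v::ab_group_add \<Rightarrow> 'v) \<Rightarrow> ('a \<times> ('v \<Rightarrow> 'k)) set"
  where "hat_carrier sV = UNIV \<times> dual_space sV"

text \<open>Sums, differences and negatives of actions below are pointwise.\<close>

definition hat_ast ::
  "('a \<Rightarrow> 'a \<Rightarrow> 'a) \<Rightarrow> ('a \<Rightarrow> 'v \<Rightarrow> 'v) \<Rightarrow> ('a \<Rightarrow> 'v \<Rightarrow> 'v) \<Rightarrow>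
   'a \<times> ('v \<Rightarrow> 'k::field) \<Rightarrow> 'a \<times> ('v \<Rightarrow> 'k) \<Rightarrow> 'a \<times> ('v \<Rightarrow> 'k)"
  where "hat_ast ast la ra =
    semidirect_op ast (dual_action la + dual_action ra) (- dual_action ra)"

definition hat_circ ::
  "('a \<Rightarrow> 'a \<Rightarrow> 'a) \<Rightarrow> ('a \<Rightarrow> 'v \<Rightarrow> 'v) \<Rightarrow> ('a \<Rightarrow> 'v \<Rightarrow> 'v) \<Rightarrow>
   'a \<times> ('v \<Rightarrow> 'k::field) \<Rightarrow> 'a \<times> ('v \<Rightarrow> 'k) \<Rightarrow> 'a \<times> ('v \<Rightarrow> 'k)"
  where "hat_circ circ lc rc =
    semidirect_op circ (dual_action rc - dual_action lc) (dual_action rc)"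


section \<open>Tensor powers\<close>

text \<open>\<open>B \<otimes> B\<close> and \<open>B \<otimes> B \<otimes> B\<close> over the field, as quotients of the free abelian groups on
  \<open>B \<times> B\<close> and \<open>B \<times> B \<times> B\<close> by additivity in each slot and by balancedness of the scalars. Formal
  integer combinations of tuples suffice, since scalars can be absorbed into a slot. The quotients
  are HOL-Algebra groups, so tensors are added with \<open>\<otimes>\<close>, negated with \<open>inv\<close>, and
  the zero tensor is \<open>\<one>\<close>.\<close>

definition tensor2_relators ::
  "('k::field \<Rightarrow> 'b::ab_group_add \<Rightarrow> 'b) \<Rightarrow> 'b set \<Rightarrow> ('b \<times> 'b \<Rightarrow>\<^sub>0 int) set"
  where "tensor2_relators scale B =
    {frag_of (x + x', y) - frag_of (x, y) - frag_of (x', y) | x x' y. x \<in> B \<and> x' \<in> B \<and> y \<in> B} \<union>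
    {frag_of (x, y + y') - frag_of (x, y) - frag_of (x, y') | x y y'. x \<in> B \<and> y \<in> B \<and> y' \<in> B} \<union>
    {frag_of (scale c x, y) - frag_of (x, scale c y) | c x y. x \<in> B \<and> y \<in> B}"

definition tensor2_null ::
  "('k::field \<Rightarrow> 'b::ab_group_add \<Rightarrow> 'b) \<Rightarrow> 'b set \<Rightarrow> ('b \<times> 'b \<Rightarrow>\<^sub>0 int) set"
  where "tensor2_null scale B =
    generate (free_Abelian_group (B \<times> B)) (tensor2_relators scale B)"

definition tensor2 ::
  "('k::field \<Rightarrow> 'b::ab_group_add \<Rightarrow> 'b) \<Rightarrow> 'b set \<Rightarrow> ('b \<times> 'b \<Rightarrow>\<^sub>0 int) set monoid"
  where "tensor2 scale B = free_Abelian_group (B \<times> B) Mod tensor2_null scale B"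

definition tensor2_class ::
  "('k::field \<Rightarrow> 'b::ab_group_add \<Rightarrow> 'b) \<Rightarrow> 'b set \<Rightarrow> ('b \<times> 'b \<Rightarrow>\<^sub>0 int) \<Rightarrow> ('b \<times> 'b \<Rightarrow>\<^sub>0 int) set"
  where "tensor2_class scale B t = tensor2_null scale B #>\<^bsub>free_Abelian_group (B \<times> B)\<^esub> t"

definition tensor3_relators ::
  "('k::field \<Rightarrow> 'b::ab_group_add \<Rightarrow> 'b) \<Rightarrow> 'b set \<Rightarrow> ('b \<times> 'b \<times> 'b \<Rightarrow>\<^sub>0 int) set"
  where "tensor3_relators scale B =
    {frag_of (x + x', y, z) - frag_of (x, y, z) - frag_of (x', y, z)
      | x x' y z. x \<in> B \<and> x' \<in> B \<and> y \<in> B \<and> z \<in> B} \<union>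
    {frag_of (x, y + y', z) - frag_of (x, y, z) - frag_of (x, y', z)
      | x y y' z. x \<in> B \<and> y \<in> B \<and> y' \<in> B \<and> z \<in> B} \<union>
    {frag_of (x, y, z + z') - frag_of (x, y, z) - frag_of (x, y, z')
      | x y z z'. x \<in> B \<and> y \<in> B \<and> z \<in> B \<and> z' \<in> B} \<union>
    {frag_of (scale c x, y, z) - frag_of (x, scale c y, z)
      | c x y z. x \<in> B \<and> y \<in> B \<and> z \<in> B} \<union>
    {frag_of (x, scale c y, z) - frag_of (x, y, scale c z)
      | c x y z. x \<in> B \<and> y \<in> B \<and> z \<in> B}"

definition tensor3_null ::
  "('k::field \<Rightarrow> 'b::ab_group_add \<Rightarrow> 'b) \<Rightarrow> 'b set \<Rightarrow> ('b \<times> 'b \<times> 'b \<Rightarrow>\<^sub>0 int) set"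
  where "tensor3_null scale B =
    generate (free_Abelian_group (B \<times> B \<times> B)) (tensor3_relators scale B)"

definition tensor3 ::
  "('k::field \<Rightarrow> 'b::ab_group_add \<Rightarrow> 'b) \<Rightarrow> 'b set \<Rightarrow> ('b \<times> 'b \<times> 'b \<Rightarrow>\<^sub>0 int) set monoid"
  where "tensor3 scale B = free_Abelian_group (B \<times> B \<times> B) Mod tensor3_null scale B"

definition tensor3_class ::
  "('k::field \<Rightarrow> 'b::ab_group_add \<Rightarrow> 'b) \<Rightarrow> 'b set \<Rightarrow>
   ('b \<times> 'b \<times> 'b \<Rightarrow>\<^sub>0 int) \<Rightarrow> ('b \<times> 'b \<times> 'b \<Rightarrow>\<^sub>0 int) set"
  where "tensor3_class scale B t = tensor3_null scale B #>\<^bsub>free_Abelian_group (B \<times> B \<times> B)\<^esub> t"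

text \<open>The flip permutes the relators up to sign, so the image of a class is again a class.\<close>

definition tensor_flip :: "('b \<times> 'b \<Rightarrow>\<^sub>0 int) set \<Rightarrow> ('b \<times> 'b \<Rightarrow>\<^sub>0 int) set"
  where "tensor_flip r = frag_extend (\<lambda>(x, y). frag_of (y, x)) ` r"

definition skew_symmetric_tensor ::
  "('k::field \<Rightarrow> 'b::ab_group_add \<Rightarrow> 'b) \<Rightarrow> 'b set \<Rightarrow> ('b \<times> 'b \<Rightarrow>\<^sub>0 int) set \<Rightarrow> bool"
  where "skew_symmetric_tensor scale B r \<longleftrightarrow> tensor_flip r = inv\<^bsub>tensor2 scale B\<^esub> r"


section \<open>The anti-pre-Poisson Yang-Baxter equation\<close>

text \<open>On a formal sum \<open>\<Sum>\<^sub>i a\<^sub>i \<otimes> b\<^sub>i\<close>, the nested extension is the double sum over \<open>i, j\<close>,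
  with \<open>(a, b) = (a\<^sub>i, b\<^sub>i)\<close> and \<open>(a', b') = (a\<^sub>j, b\<^sub>j)\<close>.\<close>

definition D_formal :: "('b \<Rightarrow> 'b \<Rightarrow> 'b::ab_group_add) \<Rightarrow> ('b \<times> 'b \<Rightarrow>\<^sub>0 int) \<Rightarrow> ('b \<times> 'b \<times> 'b \<Rightarrow>\<^sub>0 int)"
  where "D_formal ast t =
    frag_extend (\<lambda>(a, b). frag_extend (\<lambda>(a', b').
      frag_of (a, ast b a', b') - frag_of (ast a a', b, b') + frag_of (a, a', ast b b' + ast b' b)) t) t"

definition S_formal :: "('b \<Rightarrow> 'b \<Rightarrow> 'b::ab_group_add) \<Rightarrow> ('b \<times> 'b \<Rightarrow>\<^sub>0 int) \<Rightarrow> ('b \<times> 'b \<times> 'b \<Rightarrow>\<^sub>0 int)"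
  where "S_formal circ t =
    frag_extend (\<lambda>(a, b). frag_extend (\<lambda>(a', b').
      frag_of (circ a a', b, b') + frag_of (a, circ b a', b') - frag_of (a, a', circ b b' - circ b' b)) t) t"

text \<open>The induced maps \<open>B \<otimes> B \<rightarrow> B \<otimes> B \<otimes> B\<close>. All representatives of \<open>r\<close> give the same class when
  the operation is bilinear, so the union is that class.\<close>

definition D_tensor ::
  "('k::field \<Rightarrow> 'b::ab_group_add \<Rightarrow> 'b) \<Rightarrow> 'b set \<Rightarrow> ('b \<Rightarrow> 'b \<Rightarrow> 'b) \<Rightarrow>
   ('b \<times> 'b \<Rightarrow>\<^sub>0 int) set \<Rightarrow> ('b \<times> 'b \<times> 'b \<Rightarrow>\<^sub>0 int) set"
  where "D_tensor scale B ast r = (\<Union>t\<in>r. tensor3_class scale B (D_formal ast t))"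

definition S_tensor ::
  "('k::field \<Rightarrow> 'b::ab_group_add \<Rightarrow> 'b) \<Rightarrow> 'b set \<Rightarrow> ('b \<Rightarrow> 'b \<Rightarrow> 'b) \<Rightarrow>
   ('b \<times> 'b \<Rightarrow>\<^sub>0 int) set \<Rightarrow> ('b \<times> 'b \<times> 'b \<Rightarrow>\<^sub>0 int) set"
  where "S_tensor scale B circ r = (\<Union>t\<in>r. tensor3_class scale B (S_formal circ t))"

definition APP_YBE_solution ::
  "('k::field \<Rightarrow> 'b::ab_group_add \<Rightarrow> 'b) \<Rightarrow> 'b set \<Rightarrow> ('b \<Rightarrow> 'b \<Rightarrow> 'b) \<Rightarrow> ('b \<Rightarrow> 'b \<Rightarrow> 'b) \<Rightarrow>
   ('b \<times> 'b \<Rightarrow>\<^sub>0 int) set \<Rightarrow> bool"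
  where "APP_YBE_solution scale B ast circ r \<longleftrightarrow>
    r \<in> carrier (tensor2 scale B) \<and>
    D_tensor scale B ast r = \<one>\<^bsub>tensor3 scale B\<^esub> \<and>
    S_tensor scale B circ r = \<one>\<^bsub>tensor3 scale B\<^esub>"


section \<open>A linear map as a tensor\<close>

text \<open>\<open>T\<close> corresponds to \<open>\<Sum>\<^sub>b T(b) \<otimes> b\<^sup>*\<close> over the given basis of \<open>V\<close>.\<close>

definition map_tensor ::
  "('k::field \<Rightarrow> 'a::ab_group_add \<Rightarrow> 'a) \<Rightarrow> ('k \<Rightarrow> 'v::ab_group_add \<Rightarrow> 'v) \<Rightarrow> 'v set \<Rightarrow> ('v \<Rightarrow> 'a) \<Rightarrow>
   (('a \<times> ('v \<Rightarrow> 'k)) \<times> ('a \<times> ('v \<Rightarrow> 'k)) \<Rightarrow>\<^sub>0 int) set"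
  where "map_tensor sA sV Basis T = tensor2_class (hat_scale sA) (hat_carrier sV)
    (\<Sum>b\<in>Basis. frag_of ((T b, 0), (0, dual_basis sV Basis b)))"

definition skew_map_tensor ::
  "('k::field \<Rightarrow> 'a::ab_group_add \<Rightarrow> 'a) \<Rightarrow> ('k \<Rightarrow> 'v::ab_group_add \<Rightarrow> 'v) \<Rightarrow> 'v set \<Rightarrow> ('v \<Rightarrow> 'a) \<Rightarrow>
   (('a \<times> ('v \<Rightarrow> 'k)) \<times> ('a \<times> ('v \<Rightarrow> 'k)) \<Rightarrow>\<^sub>0 int) set"
  where "skew_map_tensor sA sV Basis T =
    (let G = tensor2 (hat_scale sA) (hat_carrier sV); t = map_tensor sA sV Basis T
     in t \<otimes>\<^bsub>G\<^esub> inv\<^bsub>G\<^esub> tensor_flip t)"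

end

theory Submission
  imports Defs
begin

text \<open>
  Write \<open>e b = (T b, 0)\<close> and \<open>\<epsilon> b = (0, b\<^sup>*)\<close> for \<open>b\<close> in the basis of \<open>V\<close>, so that
  \<open>r = \<Sum>\<^sub>b e b \<otimes> \<epsilon> b - \<epsilon> b \<otimes> e b\<close>. Expanding \<open>D(r)\<close> or \<open>S(r)\<close> gives double sums over the basis whose
  entries are products in the semi-direct product. A product of two functionals vanishes, a product
  of two vectors \<open>e i\<close>, \<open>e j\<close> is \<open>T i \<cdot> T j\<close>, and a mixed product is a functional of the form
  \<open>i\<^sup>* \<circ> h\<close> with \<open>h\<close> an action on \<open>V\<close>. In the mixed case \<open>h\<close> can be moved to the other factor,
  \<open>\<Sum>\<^sub>i T i \<otimes> (i\<^sup>* \<circ> h) = \<Sum>\<^sub>k T (h k) \<otimes> k\<^sup>*\<close> (lemma \<open>naturality\<close>). Afterwards every summand has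
  two dual basis vectors and one element of \<open>A\<close>, and these elements add up to the defect
  \<open>E u v = T u \<cdot> T v - T (l (T u) v + r (T v) u)\<close> of the \<open>\<O>\<close>-operator identity. Up to signs, \<open>D(r)\<close>
  and \<open>S(r)\<close> are the sum over \<open>i, j\<close> of
  \<open>E i j \<otimes> i\<^sup>* \<otimes> j\<^sup>*\<close>, \<open>i\<^sup>* \<otimes> E i j \<otimes> j\<^sup>*\<close> and \<open>i\<^sup>* \<otimes> j\<^sup>* \<otimes> (E i j \<plusminus> E j i)\<close>
  (lemma \<open>yang_baxter_defect\<close>). This vanishes if \<open>E = 0\<close>. Conversely, evaluating the last two
  slots at basis vectors \<open>b\<close>, \<open>c\<close> of \<open>V\<close> and projecting the first slot to \<open>A\<close> leaves \<open>\<plusminus> E b c\<close>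
  (lemma \<open>defect_zero_basis\<close>), and \<open>E\<close> is bilinear.

  The equations \<open>D(r) = 0\<close> and \<open>S(r) = 0\<close> are the same statement up to one sign: both are
  instances of an equation depending on \<open>s \<in> {+, -}\<close>, and so are the two semi-direct product
  operations.

  Tensors are classes of formal sums, so all identities between them are
  congruences modulo the subgroup of null sums. The equations are stated for all representatives of
  \<open>r\<close>; a bilinear operation makes the choice of representative immaterial
  (lemma \<open>Union_yang_baxter_class\<close>), and the computation uses the representative above.
\<close>

section \<open>Congruence modulo an additive subgroup\<close>

locale subgroup_add =
  fixes N :: "'g::ab_group_add set"
  assumes zero_mem: "0 \<in> N"
    and diff_mem: "a \<in> N \<Longrightarrow> b \<in> N \<Longrightarrow> a - b \<in> N"
begin

lemma uminus_mem: "a \<in> N \<Longrightarrow> - a \<in> N"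
  using diff_mem[OF zero_mem, of a] by simp

lemma add_mem: "a \<in> N \<Longrightarrow> b \<in> N \<Longrightarrow> a + b \<in> N"
  using diff_mem[of a "- b"] uminus_mem[of b] by simp

lemma sum_mem: "(\<And>i. i \<in> I \<Longrightarrow> f i \<in> N) \<Longrightarrow> sum f I \<in> N"
  by (induction I rule: infinite_finite_induct) (auto intro: zero_mem add_mem)

lemma mem_cong: "a - b \<in> N \<Longrightarrow> a \<in> N \<longleftrightarrow> b \<in> N"
  using add_mem[of "a - b" b] diff_mem[of a "a - b"] by auto

end

lemma subgroup_add_zero: "subgroup_add {0}"
  by unfold_locales auto

text \<open>The sign that distinguishes the equation for \<open>D\<close> (\<open>True\<close>) from that for \<open>S\<close> (\<open>False\<close>). A
  truth value serves for elements of any group, in particular for formal sums and for algebra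
  elements, which have different scalars.\<close>

definition signed :: "bool \<Rightarrow> 'g::ab_group_add \<Rightarrow> 'g"
  where "signed s x = (if s then x else - x)"

lemma signed_sum: "signed s (sum f I) = (\<Sum>i\<in>I. signed s (f i))"
  by (simp add: signed_def sum_negf)

lemma (in subgroup_add) signed_mem: "a \<in> N \<Longrightarrow> signed s a \<in> N"
  by (simp add: signed_def uminus_mem)

section \<open>Balanced maps modulo a subgroup\<close>

locale carrier_subspace = vector_space scale
  for scale :: "'k::field \<Rightarrow> 'b::ab_group_add \<Rightarrow> 'b" +
  fixes B :: "'b set"
  assumes subspace_B: "subspace B"
begin

lemma B_closed: "0 \<in> B" "x \<in> B \<Longrightarrow> y \<in> B \<Longrightarrow> x + y \<in> B" "x \<in> B \<Longrightarrow> scale c x \<in> B"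
    "x \<in> B \<Longrightarrow> - x \<in> B" "x \<in> B \<Longrightarrow> signed s x \<in> B"
  using subspace_B by (auto simp: subspace_0 subspace_add subspace_scale subspace_neg signed_def)

definition linear_on :: "('b \<Rightarrow> 'b) \<Rightarrow> bool"
  where "linear_on g \<longleftrightarrow> (\<forall>x\<in>B. g x \<in> B) \<and> (\<forall>x\<in>B. \<forall>y\<in>B. g (x + y) = g x + g y) \<and>
    (\<forall>c. \<forall>x\<in>B. g (scale c x) = scale c (g x))"

text \<open>These are the maps that induce a homomorphism from \<open>B \<otimes> B\<close> to the quotient by \<open>N\<close>. Working
  modulo \<open>N\<close> instead of in the quotient keeps all values in one type.\<close>

definition balanced :: "'g::ab_group_add set \<Rightarrow> ('b \<Rightarrow> 'b \<Rightarrow> 'g) \<Rightarrow> bool"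
  where "balanced N g \<longleftrightarrow>
    (\<forall>x\<in>B. \<forall>x'\<in>B. \<forall>y\<in>B. g (x + x') y - g x y - g x' y \<in> N) \<and>
    (\<forall>x\<in>B. \<forall>y\<in>B. \<forall>y'\<in>B. g x (y + y') - g x y - g x y' \<in> N) \<and>
    (\<forall>c. \<forall>x\<in>B. \<forall>y\<in>B. g (scale c x) y - g x (scale c y) \<in> N)"

lemma balancedD:
  assumes "balanced N g" "x \<in> B" "y \<in> B"
  shows "x' \<in> B \<Longrightarrow> g (x + x') y - g x y - g x' y \<in> N"
    and "y' \<in> B \<Longrightarrow> g x (y + y') - g x y - g x y' \<in> N"
    and "g (scale c x) y - g x (scale c y) \<in> N"
  using assms by (auto simp: balanced_def)

lemma balanced_compose_left: "balanced N g \<Longrightarrow> linear_on h \<Longrightarrow> balanced N (\<lambda>x y. g (h x) y)"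
  unfolding balanced_def linear_on_def by (auto simp: B_closed)

lemma balanced_compose_right: "balanced N g \<Longrightarrow> linear_on h \<Longrightarrow> balanced N (\<lambda>x y. g x (h y))"
  unfolding balanced_def linear_on_def by (auto simp: B_closed)

context
  fixes N :: "'g::ab_group_add set"
  assumes N: "subgroup_add N"
begin

interpretation subgroup_add N by (rule N)

lemma balanced_swap:
  assumes "balanced N g" shows "balanced N (\<lambda>x y. g y x)"
proof -
  have "g y (scale c x) - g (scale c y) x \<in> N" if "x \<in> B" "y \<in> B" for c x y
    using uminus_mem[OF balancedD(3)[OF assms that(2,1), of c]] by simp
  then show ?thesis
    using assms by (simp add: balanced_def)
qed

lemma balanced_add:
  assumes "balanced N g" "balanced N h"
  shows "balanced N (\<lambda>x y. g x y + h x y)"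
  unfolding balanced_def
proof (intro conjI ballI allI)
  fix x x' y assume "x \<in> B" "x' \<in> B" "y \<in> B"
  then have "(g (x + x') y - g x y - g x' y) + (h (x + x') y - h x y - h x' y) \<in> N"
    by (intro add_mem balancedD assms)
  then show "g (x + x') y + h (x + x') y - (g x y + h x y) - (g x' y + h x' y) \<in> N"
    by (simp add: algebra_simps)
next
  fix x y y' assume "x \<in> B" "y \<in> B" "y' \<in> B"
  then have "(g x (y + y') - g x y - g x y') + (h x (y + y') - h x y - h x y') \<in> N"
    by (intro add_mem balancedD assms)
  then show "g x (y + y') + h x (y + y') - (g x y + h x y) - (g x y' + h x y') \<in> N"
    by (simp add: algebra_simps)
next
  fix c x y assume "x \<in> B" "y \<in> B"
  then have "(g (scale c x) y - g x (scale c y)) + (h (scale c x) y - h x (scale c y)) \<in> N"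
    by (intro add_mem balancedD assms)
  then show "g (scale c x) y + h (scale c x) y - (g x (scale c y) + h x (scale c y)) \<in> N"
    by (simp add: algebra_simps)
qed

lemma balanced_uminus:
  assumes "balanced N g" shows "balanced N (\<lambda>x y. - g x y)"
  unfolding balanced_def
proof (intro conjI ballI allI)
  fix x x' y assume "x \<in> B" "x' \<in> B" "y \<in> B"
  then have "- (g (x + x') y - g x y - g x' y) \<in> N"
    by (intro uminus_mem balancedD assms)
  then show "- g (x + x') y - - g x y - - g x' y \<in> N"
    by (simp add: algebra_simps)
next
  fix x y y' assume "x \<in> B" "y \<in> B" "y' \<in> B"
  then have "- (g x (y + y') - g x y - g x y') \<in> N"
    by (intro uminus_mem balancedD assms)
  then show "- g x (y + y') - - g x y - - g x y' \<in> N"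
    by (simp add: algebra_simps)
next
  fix c x y assume "x \<in> B" "y \<in> B"
  then have "- (g (scale c x) y - g x (scale c y)) \<in> N"
    by (intro uminus_mem balancedD assms)
  then show "- g (scale c x) y - - g x (scale c y) \<in> N"
    by (simp add: algebra_simps)
qed

lemma balanced_signed: "balanced N g \<Longrightarrow> balanced N (\<lambda>x y. signed s (g x y))"
  by (cases s) (simp_all add: signed_def balanced_uminus)

lemma balanced_diff:
  assumes "balanced N g" "balanced N h"
  shows "balanced N (\<lambda>x y. g x y - h x y)"
  using balanced_add[OF assms(1) balanced_uminus[OF assms(2)]] by simp

lemma balanced_zero_left:
  assumes "balanced N g" "y \<in> B" shows "g 0 y \<in> N"
  using uminus_mem[OF balancedD(1)[OF assms(1) B_closed(1) assms(2) B_closed(1)]] by simp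

lemma balanced_sum_left:
  assumes g: "balanced N g" and y: "y \<in> B" and X: "\<And>i. i \<in> I \<Longrightarrow> X i \<in> B"
  shows "g (\<Sum>i\<in>I. X i) y - (\<Sum>i\<in>I. g (X i) y) \<in> N"
  using X
proof (induction I rule: infinite_finite_induct)
  case (insert i I)
  have "(\<Sum>i\<in>I. X i) \<in> B"
    using insert.prems subspace_B by (intro subspace_sum) auto
  then have "(g (X i + sum X I) y - g (X i) y - g (sum X I) y) +
      (g (sum X I) y - (\<Sum>i\<in>I. g (X i) y)) \<in> N"
    using insert y by (intro add_mem balancedD(1)[OF g]) auto
  then show ?case
    using insert.hyps by (simp add: algebra_simps)
qed (use balanced_zero_left[OF g y] in simp_all)

lemma balanced_sum_right:
  assumes "balanced N g" "x \<in> B" "\<And>i. i \<in> I \<Longrightarrow> Y i \<in> B"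
  shows "g x (\<Sum>i\<in>I. Y i) - (\<Sum>i\<in>I. g x (Y i)) \<in> N"
  using balanced_sum_left[OF balanced_swap[OF assms(1)] assms(2,3)] .

end

end

section \<open>Null sums and the universal property of the tensor powers\<close>

lemma keys_diff_subset:
  "Poly_Mapping.keys a \<subseteq> S \<Longrightarrow> Poly_Mapping.keys b \<subseteq> S \<Longrightarrow> Poly_Mapping.keys (a - b :: 'c \<Rightarrow>\<^sub>0 int) \<subseteq> S"
  using keys_diff[of a b] by auto

text \<open>An additive map is controlled by its values on generators. Compatibility with
  differences already implies compatibility with zero, negatives and sums.\<close>

lemma generate_free_Abelian_group_induct:
  assumes "t \<in> generate (free_Abelian_group S) R" "R \<subseteq> carrier (free_Abelian_group S)"
    and N: "subgroup_add N" and h: "\<And>s t. h (s - t) = h s - h t"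
    and R: "\<And>t. t \<in> R \<Longrightarrow> h t \<in> N"
  shows "h t \<in> N"
proof -
  interpret subgroup_add N by (rule N)
  have h0: "h 0 = 0" using h[of 0 0] by simp
  then have hm: "h (- t) = - h t" for t using h[of 0 t] by simp
  then have ha: "h (s + t) = h s + h t" for s t using h[of s "- t"] by simp
  show ?thesis
    using assms(1)
  proof induction
    case (inv t)
    then have "t \<in> carrier (free_Abelian_group S)"
      using assms(2) by blast
    then have "inv\<^bsub>free_Abelian_group S\<^esub> t = - t"
      by simp
    then show ?case using inv R by (simp add: hm uminus_mem)
  qed (auto simp: h0 ha zero_mem intro: R add_mem)
qed

lemma generate_free_Abelian_group_subgroup_add:
  assumes "R \<subseteq> carrier (free_Abelian_group S)"
  shows "subgroup_add (generate (free_Abelian_group S) R)"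
proof -
  let ?F = "free_Abelian_group S"
  have "subgroup (generate ?F R) ?F"
    using assms group.generate_is_subgroup[OF group_free_Abelian_group] by blast
  then interpret subgroup "generate ?F R" ?F .
  have "- b \<in> generate ?F R" if "b \<in> generate ?F R" for b
    using m_inv_closed[OF that] mem_carrier[OF that] by simp
  then show ?thesis
    using one_closed m_closed[of _ "- _"] by unfold_locales auto
qed

context carrier_subspace
begin

abbreviation "null2 \<equiv> tensor2_null scale B"
abbreviation "null3 \<equiv> tensor3_null scale B"

lemma tensor2_relators_carrier:
  "tensor2_relators scale B \<subseteq> carrier (free_Abelian_group (B \<times> B))"
  unfolding tensor2_relators_def
  by (safe; simp only: carrier_free_Abelian_group_iff; intro keys_diff_subset; simp add: B_closed)

lemma tensor3_relators_carrier:
  "tensor3_relators scale B \<subseteq> carrier (free_Abelian_group (B \<times> B \<times> B))"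
  unfolding tensor3_relators_def
  by (safe; simp only: carrier_free_Abelian_group_iff; intro keys_diff_subset; simp add: B_closed)

lemma subgroup_null2: "subgroup_add null2"
  unfolding tensor2_null_def
  by (rule generate_free_Abelian_group_subgroup_add[OF tensor2_relators_carrier])

lemma subgroup_null3: "subgroup_add null3"
  unfolding tensor3_null_def
  by (rule generate_free_Abelian_group_subgroup_add[OF tensor3_relators_carrier])

text \<open>The universal property of the tensor square: each relator is sent to one of the three
  expressions in the definition of \<open>balanced\<close>.\<close>

lemma additive_null2:
  assumes "t \<in> null2" "subgroup_add N" "\<And>s t. h (s - t) = h s - h t"
    and g: "balanced N (\<lambda>x y. h (frag_of (x, y)))"
  shows "h t \<in> N"
  by (rule generate_free_Abelian_group_induct[OF assms(1)[unfolded tensor2_null_def]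
        tensor2_relators_carrier assms(2,3)])
    (auto simp: tensor2_relators_def assms(3) balancedD[OF g])

text \<open>Balancedness in the first two and in the last two slots covers all five families of relators
  of the tensor cube.\<close>

lemma additive_null3:
  assumes "t \<in> null3" "subgroup_add N" "\<And>s t. h (s - t) = h s - h t"
    and "\<And>z. z \<in> B \<Longrightarrow> balanced N (\<lambda>x y. h (frag_of (x, y, z)))"
    and "\<And>x. x \<in> B \<Longrightarrow> balanced N (\<lambda>y z. h (frag_of (x, y, z)))"
  shows "h t \<in> N"
  by (rule generate_free_Abelian_group_induct[OF assms(1)[unfolded tensor3_null_def]
        tensor3_relators_carrier assms(2,3)])
    (auto simp: tensor3_relators_def assms(3) balancedD[OF assms(4)] balancedD[OF assms(5)])

lemma tensor3_relators_null3: "tensor3_relators scale B \<subseteq> null3"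
  unfolding tensor3_null_def by (auto intro: generate.incl)

text \<open>In the second claim, moving a scalar between the outer slots combines two relators, which pass
  it through the middle slot.\<close>

lemma balanced_frag_of3:
  assumes "z \<in> B"
  shows "balanced null3 (\<lambda>x y. frag_of (x, y, z))"
    and "balanced null3 (\<lambda>x y. frag_of (x, z, y))"
    and "balanced null3 (\<lambda>x y. frag_of (z, x, y))"
proof -
  interpret subgroup_add null3 by (rule subgroup_null3)
  note R = subsetD[OF tensor3_relators_null3, unfolded tensor3_relators_def]
  have m1: "frag_of (x + x', y, z) - frag_of (x, y, z) - frag_of (x', y, z) \<in> null3"
    if "x \<in> B" "x' \<in> B" "y \<in> B" "z \<in> B" for x x' y z
    using that by (intro R) blast
  have m2: "frag_of (x, y + y', z) - frag_of (x, y, z) - frag_of (x, y', z) \<in> null3"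
    if "x \<in> B" "y' \<in> B" "y \<in> B" "z \<in> B" for x y' y z
    using that by (intro R) blast
  have m3: "frag_of (x, y, z + z') - frag_of (x, y, z) - frag_of (x, y, z') \<in> null3"
    if "x \<in> B" "z' \<in> B" "y \<in> B" "z \<in> B" for x z' y z
    using that by (intro R) blast
  have m4: "frag_of (scale c x, y, z) - frag_of (x, scale c y, z) \<in> null3"
    if "x \<in> B" "y \<in> B" "z \<in> B" for c x y z
    using that by (intro R) blast
  have m5: "frag_of (x, scale c y, z) - frag_of (x, y, scale c z) \<in> null3"
    if "x \<in> B" "y \<in> B" "z \<in> B" for c x y z
    using that by (intro R) blast
  have m6: "frag_of (scale c x, y, z) - frag_of (x, y, scale c z) \<in> null3"
    if "x \<in> B" "y \<in> B" "z \<in> B" for c x y z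
    using add_mem[OF m4[OF that, of c] m5[OF that, of c]] by simp
  show "balanced null3 (\<lambda>x y. frag_of (x, y, z))"
    and "balanced null3 (\<lambda>x y. frag_of (x, z, y))"
    and "balanced null3 (\<lambda>x y. frag_of (z, x, y))"
    using assms by (auto simp: balanced_def m1 m2 m3 m4 m5 m6)
qed

lemma frag_of_zero3:
  assumes "x \<in> B" "y \<in> B"
  shows "frag_of (0, x, y) \<in> null3" "frag_of (x, 0, y) \<in> null3" "frag_of (x, y, 0) \<in> null3"
  using balanced_zero_left[OF subgroup_null3 balanced_frag_of3(1)[OF assms(2)] assms(1)]
    balanced_zero_left[OF subgroup_null3 balanced_frag_of3(3)[OF assms(1)] assms(2)]
    balanced_zero_left[OF subgroup_null3 balanced_swap[OF subgroup_null3 balanced_frag_of3(3)[OF assms(1)]] assms(2)]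
  by simp_all

end

section \<open>The Yang-Baxter expression\<close>

text \<open>The summand of \<open>D(r)\<close> (\<open>s = True\<close>) or \<open>S(r)\<close> (\<open>s = False\<close>) for the pair \<open>a \<otimes> b\<close>, \<open>a' \<otimes> b'\<close>.\<close>

definition yang_baxter_pair ::
  "bool \<Rightarrow> ('b::ab_group_add \<Rightarrow> 'b \<Rightarrow> 'b) \<Rightarrow> 'b \<Rightarrow> 'b \<Rightarrow> 'b \<Rightarrow> 'b \<Rightarrow> ('b \<times> 'b \<times> 'b \<Rightarrow>\<^sub>0 int)"
  where "yang_baxter_pair s m a b a' b' =
    frag_of (a, m b a', b') - signed s (frag_of (m a a', b, b'))
    + signed s (frag_of (a, a', m b b' + signed s (m b' b)))"

text \<open>Both equations are quadratic in \<open>r\<close>. Their polar form separates the two occurrences of \<open>r\<close>,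
  so that each can be varied by a null sum on its own.\<close>

definition yang_baxter_polar ::
  "bool \<Rightarrow> ('b::ab_group_add \<Rightarrow> 'b \<Rightarrow> 'b) \<Rightarrow> ('b \<times> 'b \<Rightarrow>\<^sub>0 int) \<Rightarrow> ('b \<times> 'b \<Rightarrow>\<^sub>0 int) \<Rightarrow> ('b \<times> 'b \<times> 'b \<Rightarrow>\<^sub>0 int)"
  where "yang_baxter_polar s m t t' =
    frag_extend (\<lambda>(a, b). frag_extend (\<lambda>(a', b'). yang_baxter_pair s m a b a' b') t') t"

lemma D_formal_eq: "D_formal m t = yang_baxter_polar True m t t"
  by (simp add: D_formal_def yang_baxter_polar_def yang_baxter_pair_def signed_def)

lemma S_formal_eq: "S_formal m t = yang_baxter_polar False m t t"
  by (simp add: S_formal_def yang_baxter_polar_def yang_baxter_pair_def signed_def algebra_simps)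

lemma yang_baxter_polar_diff_left:
  "yang_baxter_polar s m (t - u) t' = yang_baxter_polar s m t t' - yang_baxter_polar s m u t'"
  by (simp add: yang_baxter_polar_def frag_extend_diff)

lemma frag_extend_diff_fun:
  "frag_extend (\<lambda>x. f x - g x) t = frag_extend f t - frag_extend g t"
proof -
  have "Poly_Mapping.keys t \<subseteq> UNIV" by simp
  then show ?thesis
    by (induction t rule: frag_induction) (auto simp: frag_extend_diff)
qed

lemma yang_baxter_polar_diff_right:
  "yang_baxter_polar s m t (u - t') = yang_baxter_polar s m t u - yang_baxter_polar s m t t'"
  by (simp add: yang_baxter_polar_def frag_extend_diff case_prod_unfold frag_extend_diff_fun)

locale bilinear_on = carrier_subspace scale B
  for scale :: "'k::field \<Rightarrow> 'b::ab_group_add \<Rightarrow> 'b" and B +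
  fixes m :: "'b \<Rightarrow> 'b \<Rightarrow> 'b"
  assumes linear_on_left: "y \<in> B \<Longrightarrow> linear_on (\<lambda>x. m x y)"
    and linear_on_right: "x \<in> B \<Longrightarrow> linear_on (\<lambda>y. m x y)"
begin

lemma linear_on_signed_commutator:
  assumes "y \<in> B"
  shows "linear_on (\<lambda>x. m x y + signed s (m y x))" "linear_on (\<lambda>x. m y x + signed s (m x y))"
  using linear_on_left[OF assms] linear_on_right[OF assms]
  by (auto simp: linear_on_def B_closed signed_def scale_right_distrib algebra_simps)

text \<open>Each of the three terms arises from an elementary tensor by applying a linear map, built
  from multiplication operators, to one of the two slots filled by \<open>a\<close> and \<open>b\<close>.\<close>

lemma balanced_yang_baxter_left:
  assumes "a' \<in> B" "b' \<in> B"
  shows "balanced null3 (\<lambda>a b. yang_baxter_pair s m a b a' b')"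
  unfolding yang_baxter_pair_def
  by (intro balanced_add balanced_diff balanced_signed subgroup_null3
    balanced_compose_right[OF balanced_frag_of3(1), where h = "\<lambda>b. m b a'"]
    balanced_compose_left[OF balanced_frag_of3(1), where h = "\<lambda>a. m a a'"]
    balanced_compose_right[OF balanced_frag_of3(2), where h = "\<lambda>b. m b b' + signed s (m b' b)"]
    linear_on_left linear_on_signed_commutator assms)

lemma balanced_yang_baxter_right:
  assumes "a \<in> B" "b \<in> B"
  shows "balanced null3 (\<lambda>a' b'. yang_baxter_pair s m a b a' b')"
  unfolding yang_baxter_pair_def
  by (intro balanced_add balanced_diff balanced_signed subgroup_null3
    balanced_compose_left[OF balanced_frag_of3(3), where h = "\<lambda>a'. m b a'"]
    balanced_compose_left[OF balanced_frag_of3(2), where h = "\<lambda>a'. m a a'"]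
    balanced_compose_right[OF balanced_frag_of3(3), where h = "\<lambda>b'. m b b' + signed s (m b' b)"]
    linear_on_right linear_on_signed_commutator assms)

lemma yang_baxter_polar_null_left:
  assumes t: "t \<in> null2" and t': "Poly_Mapping.keys t' \<subseteq> B \<times> B"
  shows "yang_baxter_polar s m t t' \<in> null3"
  using t'
proof (induction t' rule: frag_induction)
  case zero
  show ?case
    by (simp add: yang_baxter_polar_def case_prod_unfold frag_extend_eq_0
        subgroup_add.zero_mem[OF subgroup_null3])
next
  case (one p)
  obtain a' b' where p: "p = (a', b')" "a' \<in> B" "b' \<in> B" using one by auto
  show ?case
    by (rule additive_null2[OF t subgroup_null3])
      (simp add: yang_baxter_polar_diff_left,
        simp add: yang_baxter_polar_def p balanced_yang_baxter_left)
next
  case (diff u v)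
  then show ?case
    by (simp add: yang_baxter_polar_diff_right subgroup_add.diff_mem[OF subgroup_null3])
qed

lemma yang_baxter_polar_null_right:
  assumes t: "Poly_Mapping.keys t \<subseteq> B \<times> B" and t': "t' \<in> null2"
  shows "yang_baxter_polar s m t t' \<in> null3"
  using t
proof (induction t rule: frag_induction)
  case zero
  then show ?case
    by (simp add: yang_baxter_polar_def subgroup_add.zero_mem[OF subgroup_null3])
next
  case (one p)
  obtain a b where p: "p = (a, b)" "a \<in> B" "b \<in> B" using one by auto
  show ?case
    by (rule additive_null2[OF t' subgroup_null3])
      (simp add: yang_baxter_polar_diff_right,
        simp add: yang_baxter_polar_def p balanced_yang_baxter_right)
next
  case (diff u v)
  then show ?case
    by (simp add: yang_baxter_polar_diff_left subgroup_add.diff_mem[OF subgroup_null3])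
qed

text \<open>A quadratic map changes by \<open>Q(t - u, t) + Q(u, t - u)\<close>, and each summand has a null argument.\<close>

lemma yang_baxter_well_defined:
  assumes t: "Poly_Mapping.keys t \<subseteq> B \<times> B" and u: "Poly_Mapping.keys u \<subseteq> B \<times> B"
    and tu: "t - u \<in> null2"
  shows "yang_baxter_polar s m t t - yang_baxter_polar s m u u \<in> null3"
proof -
  have "yang_baxter_polar s m t t - yang_baxter_polar s m u u
      = yang_baxter_polar s m (t - u) t + yang_baxter_polar s m u (t - u)"
    by (simp add: yang_baxter_polar_diff_left yang_baxter_polar_diff_right)
  then show ?thesis
    using assms by (simp add: subgroup_add.add_mem[OF subgroup_null3]
        yang_baxter_polar_null_left yang_baxter_polar_null_right)
qed

end

section \<open>Classes of formal sums\<close>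

abbreviation frag_flip :: "('b \<times> 'b \<Rightarrow>\<^sub>0 int) \<Rightarrow> ('b \<times> 'b \<Rightarrow>\<^sub>0 int)"
  where "frag_flip \<equiv> frag_extend (\<lambda>(x, y). frag_of (y, x))"

lemma frag_flip_flip: "frag_flip (frag_flip t) = t"
proof -
  have "Poly_Mapping.keys t \<subseteq> UNIV" by simp
  then show ?thesis
    by (induction t rule: frag_induction) (auto simp: frag_extend_diff)
qed

context carrier_subspace
begin

lemma tensor2_class_eq: "tensor2_class scale B t = (\<lambda>n. n + t) ` null2"
  by (auto simp: tensor2_class_def r_coset_def)

lemma tensor3_class_eq: "tensor3_class scale B t = (\<lambda>n. n + t) ` null3"
  by (auto simp: tensor3_class_def r_coset_def)

lemma normal_null2: "normal null2 (free_Abelian_group (B \<times> B))"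
  unfolding tensor2_null_def
  using tensor2_relators_carrier
  by (simp add: comm_group.normal_iff_subgroup[OF abelian_free_Abelian_group]
      group.generate_is_subgroup)

lemma null2_carrier: "t \<in> null2 \<Longrightarrow> Poly_Mapping.keys t \<subseteq> B \<times> B"
  using normal_imp_subgroup[OF normal_null2] subgroup.mem_carrier by fastforce

lemma tensor2_class_carrier:
  "Poly_Mapping.keys t \<subseteq> B \<times> B \<Longrightarrow> tensor2_class scale B t \<in> carrier (tensor2 scale B)"
  by (auto simp: tensor2_def tensor2_class_def carrier_FactGroup)

lemma tensor2_class_add:
  assumes "Poly_Mapping.keys t \<subseteq> B \<times> B" "Poly_Mapping.keys u \<subseteq> B \<times> B"
  shows "tensor2_class scale B t \<otimes>\<^bsub>tensor2 scale B\<^esub> tensor2_class scale B u = tensor2_class scale B (t + u)"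
  using assms by (simp add: tensor2_def tensor2_class_def normal.rcos_sum[OF normal_null2])

lemma tensor2_class_inv:
  assumes t: "Poly_Mapping.keys t \<subseteq> B \<times> B"
  shows "inv\<^bsub>tensor2 scale B\<^esub> tensor2_class scale B t = tensor2_class scale B (- t)"
  using tensor2_class_carrier[OF t] t
  by (simp add: tensor2_def tensor2_class_def normal.inv_FactGroup[OF normal_null2]
      normal.rcos_inv[OF normal_null2])

lemma balanced_frag_of2: "balanced null2 (\<lambda>x y. frag_of (x, y))"
proof -
  have "tensor2_relators scale B \<subseteq> null2"
    unfolding tensor2_null_def by (auto intro: generate.incl)
  note R = subsetD[OF this, unfolded tensor2_relators_def]
  show ?thesis
    unfolding balanced_def by (intro conjI ballI allI R) blast+
qed

lemma frag_flip_null2: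
  assumes "t \<in> null2" shows "frag_flip t \<in> null2"
  by (rule additive_null2[OF assms subgroup_null2])
    (simp_all add: frag_extend_diff balanced_swap[OF subgroup_null2 balanced_frag_of2])

lemma tensor_flip_class:
  "tensor_flip (tensor2_class scale B t) = tensor2_class scale B (frag_flip t)"
proof -
  have "n \<in> frag_flip ` null2" if "n \<in> null2" for n
    using imageI[OF frag_flip_null2[OF that], of frag_flip] by (simp add: frag_flip_flip)
  then have "frag_flip ` null2 = null2"
    using frag_flip_null2 by blast
  then have "(\<lambda>n. n + frag_flip t) ` null2 = (\<lambda>n. n + frag_flip t) ` frag_flip ` null2"
    by simp
  then show ?thesis
    by (simp add: tensor_flip_def tensor2_class_eq image_image frag_extend_add)
qed

end

context bilinear_on
begin

text \<open>The class computed from one representative is null exactly when all of them are; this reduces an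
  equation between tensors to a membership of a single formal sum.\<close>

lemma Union_yang_baxter_class:
  assumes t: "Poly_Mapping.keys t \<subseteq> B \<times> B"
  shows "(\<Union>u\<in>tensor2_class scale B t. tensor3_class scale B (yang_baxter_polar s m u u))
      = \<one>\<^bsub>tensor3 scale B\<^esub> \<longleftrightarrow> yang_baxter_polar s m t t \<in> null3"
    (is "?U = _ \<longleftrightarrow> ?Y t \<in> null3")
proof -
  interpret n3: subgroup_add null3 by (rule subgroup_null3)
  interpret n2: subgroup_add null2 by (rule subgroup_null2)
  have Y: "?Y u \<in> null3 \<longleftrightarrow> ?Y t \<in> null3" if u: "u \<in> tensor2_class scale B t" for u
  proof -
    obtain n where n: "n \<in> null2" "u = n + t"
      using u by (auto simp: tensor2_class_eq)
    then have "Poly_Mapping.keys u \<subseteq> B \<times> B"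
      using keys_add[of n t] null2_carrier[of n] t by auto
    then show ?thesis
      using yang_baxter_well_defined[of u t] n t by (intro n3.mem_cong) simp
  qed
  have cl: "tensor3_class scale B w = null3" if w: "w \<in> null3" for w
    using n3.add_mem[OF _ w] n3.diff_mem[OF _ w]
    by (force simp: tensor3_class_eq image_iff)
  have t_mem: "t \<in> tensor2_class scale B t"
    using imageI[OF n2.zero_mem, of "\<lambda>n. n + t"] by (simp add: tensor2_class_eq)
  have "?Y t \<in> tensor3_class scale B (?Y t)"
    using imageI[OF n3.zero_mem, of "\<lambda>n. n + ?Y t"] by (simp add: tensor3_class_eq)
  then have "?Y t \<in> ?U"
    using t_mem by blast
  moreover have "?U = null3" if "?Y t \<in> null3"
  proof -
    have "tensor3_class scale B (?Y u) = null3" if u: "u \<in> tensor2_class scale B t" for u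
      using Y[OF u] \<open>?Y t \<in> null3\<close> by (intro cl) simp
    then have "?U = (\<Union>u\<in>tensor2_class scale B t. null3)"
      by (intro SUP_cong refl)
    then show ?thesis
      using t_mem by blast
  qed
  ultimately have "?U = null3 \<longleftrightarrow> ?Y t \<in> null3"
    by blast
  then show ?thesis
    by (simp add: tensor3_def)
qed

end

section \<open>The semi-direct product and coordinates\<close>

lemma sum_apply: "(\<Sum>i\<in>I. F i) v = (\<Sum>i\<in>I. F i v)"
  for F :: "'i \<Rightarrow> 'c \<Rightarrow> 'd::comm_monoid_add"
  by (induction I rule: infinite_finite_induct) simp_all

text \<open>With \<open>\<sigma> = \<plusminus>1\<close> for the sign \<open>s\<close>, both operations of the semi-direct product have left action
  \<open>r\<^sup>* + \<sigma> l\<^sup>*\<close> and right action \<open>- \<sigma> r\<^sup>*\<close>.\<close>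

definition hat_product ::
  "bool \<Rightarrow> ('a \<Rightarrow> 'a \<Rightarrow> 'a) \<Rightarrow> ('a \<Rightarrow> 'v \<Rightarrow> 'v) \<Rightarrow> ('a \<Rightarrow> 'v \<Rightarrow> 'v) \<Rightarrow>
   'a \<times> ('v \<Rightarrow> 'k::field) \<Rightarrow> 'a \<times> ('v \<Rightarrow> 'k) \<Rightarrow> 'a \<times> ('v \<Rightarrow> 'k)"
  where "hat_product s p l r =
    semidirect_op p (dual_action r + signed s (dual_action l)) (- signed s (dual_action r))"

lemma hat_ast_eq: "hat_ast p l r = hat_product True p l r"
  by (simp add: hat_ast_def hat_product_def signed_def add.commute)

lemma hat_circ_eq: "hat_circ p l r = hat_product False p l r"
  by (simp add: hat_circ_def hat_product_def signed_def)

text \<open>One of the two operations of the algebra together with its left and right actions.\<close>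

locale signed_semidirect =
  A: vector_space sA + V: finite_dimensional_vector_space sV Basis
  for sA :: "'k::field \<Rightarrow> 'a::ab_group_add \<Rightarrow> 'a"
    and sV :: "'k \<Rightarrow> 'v::ab_group_add \<Rightarrow> 'v" and Basis :: "'v set" +
  fixes s :: bool and p :: "'a \<Rightarrow> 'a \<Rightarrow> 'a" and l r :: "'a \<Rightarrow> 'v \<Rightarrow> 'v" and T :: "'v \<Rightarrow> 'a"
  assumes p_linear: "Vector_Spaces.linear sA sA (\<lambda>x. p x y)" "Vector_Spaces.linear sA sA (\<lambda>y. p x y)"
    and l_linear: "linear_to_End sA sV l" and r_linear: "linear_to_End sA sV r"
    and T_linear: "Vector_Spaces.linear sV sA T"
begin

lemma linear_simps:
  "p (x + x') y = p x y + p x' y" "p x (y + y') = p x y + p x y'"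
  "p (sA c x) y = sA c (p x y)" "p x (sA c y) = sA c (p x y)"
  "l (x + x') v = l x v + l x' v" "l x (v + v') = l x v + l x v'"
  "l (sA c x) v = sV c (l x v)" "l x (sV c v) = sV c (l x v)"
  "r (x + x') v = r x v + r x' v" "r x (v + v') = r x v + r x v'"
  "r (sA c x) v = sV c (r x v)" "r x (sV c v) = sV c (r x v)"
  "T (v + v') = T v + T v'" "T (sV c v) = sA c (T v)"
  using p_linear l_linear r_linear T_linear
  by (simp_all add: Vector_Spaces.linear_iff linear_to_End_def)

lemma zero_simps: "p 0 y = 0" "p x 0 = 0" "l x 0 = 0" "l 0 v = 0" "r x 0 = 0" "r 0 v = 0" "T 0 = 0"
  using linear_simps(1)[of 0 0 y] linear_simps(2)[of x 0 0] linear_simps(5)[of 0 0 v]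
    linear_simps(6)[of x 0 0] linear_simps(9)[of 0 0 v] linear_simps(10)[of x 0 0] linear_simps(13)[of 0 0]
  by simp_all

lemma uminus_simps: "l x (- v) = - l x v" "r x (- v) = - r x v" "T (- v) = - T v"
  "T (u - v) = T u - T v"
  using linear_simps(6)[of x v "- v"] linear_simps(10)[of x v "- v"] linear_simps(13)[of v "- v"]
    linear_simps(13)[of "u - v" v]
  by (simp_all add: zero_simps eq_neg_iff_add_eq_0 add.commute)

abbreviation "dual \<equiv> dual_space sV"
abbreviation "hatB \<equiv> (hat_carrier sV :: ('a \<times> ('v \<Rightarrow> 'k)) set)"
abbreviation "hat_op \<equiv> hat_product s p l r"

lemma dual_iff: "\<phi> \<in> dual \<longleftrightarrow> (\<forall>u v. \<phi> (u + v) = \<phi> u + \<phi> v) \<and> (\<forall>c v. \<phi> (sV c v) = c * \<phi> v)"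
proof -
  have "vector_space ((*) :: 'k \<Rightarrow> 'k \<Rightarrow> 'k)"
    by unfold_locales (simp_all add: algebra_simps)
  then show ?thesis
    using V.vector_space_axioms by (auto simp: dual_space_def Vector_Spaces.linear_iff)
qed

lemma dual_0: "\<phi> \<in> dual \<Longrightarrow> \<phi> 0 = 0"
  unfolding dual_iff by (metis add_cancel_right_left add_0)

lemma dual_uminus: "\<phi> \<in> dual \<Longrightarrow> \<phi> (- v) = - \<phi> v"
  using dual_0[of \<phi>] unfolding dual_iff by (metis add.right_inverse eq_neg_iff_add_eq_0 add.commute)

lemma hat_product_Pair:
  "hat_op (x, \<phi>) (y, \<psi>) = (p x y, \<lambda>v. - \<psi> (r x v) - signed s (\<psi> (l x v)) + signed s (\<phi> (r y v)))"
  by (auto simp: hat_product_def semidirect_op_def dual_action_def signed_def fun_eq_iff)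

lemma vector_space_hat: "vector_space (hat_scale sA :: 'k \<Rightarrow> 'a \<times> ('v \<Rightarrow> 'k) \<Rightarrow> _)"
  by unfold_locales
    (auto simp: hat_scale_def fun_eq_iff algebra_simps A.scale_right_distrib A.scale_left_distrib)

sublocale hat: carrier_subspace "hat_scale sA" hatB
proof -
  interpret H: vector_space "hat_scale sA :: 'k \<Rightarrow> 'a \<times> ('v \<Rightarrow> 'k) \<Rightarrow> _"
    by (rule vector_space_hat)
  show "carrier_subspace (hat_scale sA) hatB"
    by unfold_locales
      (auto simp: H.subspace_def hat_scale_def hat_carrier_def dual_iff zero_prod_def algebra_simps)
qed

lemma hat_product_closed: "x \<in> hatB \<Longrightarrow> y \<in> hatB \<Longrightarrow> hat_op x y \<in> hatB"
  by (cases x; cases y)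
    (auto simp: hat_carrier_def hat_product_Pair dual_iff linear_simps signed_def algebra_simps)

sublocale hat: bilinear_on "hat_scale sA" hatB hat_op
proof unfold_locales
  fix y :: "'a \<times> ('v \<Rightarrow> 'k)" assume "y \<in> hatB"
  then show "hat.linear_on (\<lambda>x. hat_op x y)" "hat.linear_on (\<lambda>x. hat_op y x)"
    by (auto simp: hat.linear_on_def hat_product_closed)
       (auto simp: hat_carrier_def hat_product_Pair dual_iff linear_simps signed_def
         hat_scale_def fun_eq_iff algebra_simps)
qed

definition coord :: "'v \<Rightarrow> 'v \<Rightarrow> 'k" where "coord = dual_basis sV Basis"

lemma coord_dual: "coord b \<in> dual"
  unfolding coord_def dual_basis_def dual_iff
  by (simp add: V.representation_add V.representation_scale V.independent_Basis V.span_Basis)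

lemma coord_delta: "b \<in> Basis \<Longrightarrow> coord c b = (if c = b then 1 else 0)"
  by (simp add: coord_def dual_basis_def V.representation_basis V.independent_Basis)

lemma coord_expand: "(\<Sum>b\<in>Basis. sV (coord b v) b) = v"
  unfolding coord_def dual_basis_def
  by (rule V.sum_representation_eq) (simp_all add: V.independent_Basis V.span_Basis V.finite_Basis)

lemma linear_expand:
  assumes "Vector_Spaces.linear sV s2 F" shows "F v = (\<Sum>b\<in>Basis. s2 (coord b v) (F b))"
proof -
  interpret F: Vector_Spaces.linear sV s2 F by (rule assms)
  show ?thesis
    by (subst coord_expand[of v, symmetric]) (simp add: F.sum F.scale)
qed

text \<open>Every functional is the combination of the dual basis with its values on the basis as
  coefficients.\<close>

lemma dual_expand:
  assumes "\<phi> \<in> dual" shows "\<phi> = (\<Sum>b\<in>Basis. (\<lambda>v. \<phi> b * coord b v))"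
proof
  fix v
  have "\<phi> v = (\<Sum>b\<in>Basis. coord b v * \<phi> b)"
    using assms linear_expand[of "(*)" \<phi> v] by (simp add: dual_space_def)
  then show "\<phi> v = (\<Sum>b\<in>Basis. (\<lambda>v. \<phi> b * coord b v)) v"
    by (simp add: sum_apply mult.commute)
qed

end

section \<open>The Yang-Baxter expression of the tensor of a linear map\<close>

definition additive_mod :: "'g::ab_group_add set \<Rightarrow> ('a::ab_group_add \<Rightarrow> 'g) \<Rightarrow> bool"
  where "additive_mod N \<phi> \<longleftrightarrow> (\<forall>a b. \<phi> (a + b) - \<phi> a - \<phi> b \<in> N)"

context subgroup_add
begin

lemma additive_mod_pairs:
  assumes "additive_mod N \<phi>" "a + b = c + d"
  shows "\<phi> a + \<phi> b - \<phi> c - \<phi> d \<in> N"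
proof -
  have "(\<phi> (c + d) - \<phi> c - \<phi> d) - (\<phi> (a + b) - \<phi> a - \<phi> b) \<in> N"
    by (intro diff_mem[of "_ - _ - _" "_ - _ - _"] assms(1)[unfolded additive_mod_def, rule_format])
  then show ?thesis
    by (simp add: assms(2) algebra_simps)
qed

lemma additive_mod_triple:
  assumes "additive_mod N \<phi>" "a + b + c = d"
  shows "\<phi> a + \<phi> b + \<phi> c - \<phi> d \<in> N"
proof -
  have "(\<phi> (a + b + c) - \<phi> (a + b) - \<phi> c) + (\<phi> (a + b) - \<phi> a - \<phi> b) \<in> N"
    by (intro add_mem assms(1)[unfolded additive_mod_def, rule_format])
  then have "- (\<phi> d - \<phi> a - \<phi> b - \<phi> c) \<in> N"
    unfolding assms(2) by (intro uminus_mem) (simp add: algebra_simps)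
  then show ?thesis
    by (simp add: algebra_simps)
qed

end

context signed_semidirect
begin

abbreviation "e v \<equiv> (T v, 0 :: 'v \<Rightarrow> 'k)"
abbreviation "\<epsilon> b \<equiv> (0 :: 'a, coord b)"

lemma hatB_mem: "(a, 0) \<in> hatB" "\<epsilon> b \<in> hatB" "0 \<in> hatB"
  by (auto simp: hat_carrier_def zero_prod_def coord_dual) (simp_all add: dual_iff)

lemma comp_dual: "Vector_Spaces.linear sV sV h \<Longrightarrow> \<phi> \<in> dual \<Longrightarrow> (\<lambda>v. \<phi> (h v)) \<in> dual"
  by (simp add: dual_iff Vector_Spaces.linear_iff)

text \<open>The identity \<open>(T \<otimes> h\<^sup>*) (id) = (T \<circ> h \<otimes> 1) (id)\<close>: expand \<open>i\<^sup>* \<circ> h\<close> in the dual basis, move the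
  coefficients \<open>i\<^sup>* (h k)\<close> to the first factor, and collect the terms with the same \<open>k\<close>. A balanced map
  in place of \<open>\<otimes>\<close> makes the identity available for any two slots of the tensor cube, in either
  order.\<close>

lemma naturality:
  assumes N: "subgroup_add N" and g: "hat.balanced N g" and h: "Vector_Spaces.linear sV sV h"
  shows "(\<Sum>i\<in>Basis. g (e i) (0, \<lambda>v. coord i (h v))) - (\<Sum>k\<in>Basis. g (e (h k)) (\<epsilon> k)) \<in> N"
proof -
  interpret subgroup_add N by (rule N)
  let ?c = "\<lambda>i k. coord i (h k)"
  have 1: "(0, \<lambda>v. coord i (h v)) = (\<Sum>k\<in>Basis. hat_scale sA (?c i k) (\<epsilon> k))" for i
  proof (rule prod_eqI)
    show "snd (0, \<lambda>v. coord i (h v)) = snd (\<Sum>k\<in>Basis. hat_scale sA (?c i k) (\<epsilon> k))"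
      using dual_expand[OF comp_dual[OF h coord_dual[of i]]] by (simp add: snd_sum hat_scale_def)
  qed (simp add: fst_sum hat_scale_def)
  have 2: "e (h k) = (\<Sum>i\<in>Basis. hat_scale sA (?c i k) (e i))" for k
  proof (rule prod_eqI)
    show "fst (e (h k)) = fst (\<Sum>i\<in>Basis. hat_scale sA (?c i k) (e i))"
      using linear_expand[OF T_linear, of "h k"] by (simp add: fst_sum hat_scale_def)
  qed (simp add: snd_sum hat_scale_def zero_fun_def[symmetric])
  have "(\<Sum>i\<in>Basis. g (e i) (0, \<lambda>v. coord i (h v)) - (\<Sum>k\<in>Basis. g (e i) (hat_scale sA (?c i k) (\<epsilon> k))))
    - (\<Sum>i\<in>Basis. \<Sum>k\<in>Basis. g (hat_scale sA (?c i k) (e i)) (\<epsilon> k) - g (e i) (hat_scale sA (?c i k) (\<epsilon> k)))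
    - (\<Sum>k\<in>Basis. g (e (h k)) (\<epsilon> k) - (\<Sum>i\<in>Basis. g (hat_scale sA (?c i k) (e i)) (\<epsilon> k))) \<in> N"
    unfolding 1 2
    by (intro diff_mem[of "_ - sum _ _" "sum _ _"] diff_mem[of "sum _ _" "sum _ _"] sum_mem
        hat.balanced_sum_left[OF N g]
        hat.balanced_sum_right[OF N g] hat.balancedD(3)[OF g] hat.B_closed(3) hatB_mem)
  moreover have "(\<Sum>i\<in>Basis. \<Sum>k\<in>Basis. g (hat_scale sA (?c i k) (e i)) (\<epsilon> k))
      = (\<Sum>k\<in>Basis. \<Sum>i\<in>Basis. g (hat_scale sA (?c i k) (e i)) (\<epsilon> k))"
    by (rule sum.swap)
  ultimately show ?thesis
    by (simp add: sum_subtractf algebra_simps)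
qed

lemma naturality_double:
  assumes N: "subgroup_add N" and g: "\<And>j. j \<in> Basis \<Longrightarrow> hat.balanced N (g j)"
    and h: "\<And>j. j \<in> Basis \<Longrightarrow> Vector_Spaces.linear sV sV (h j)"
  shows "(\<Sum>j\<in>Basis. \<Sum>i\<in>Basis. g j (e i) (0, \<lambda>v. coord i (h j v)))
    - (\<Sum>j\<in>Basis. \<Sum>i\<in>Basis. g j (e (h j i)) (\<epsilon> i)) \<in> N"
proof -
  have "(\<Sum>j\<in>Basis. (\<Sum>i\<in>Basis. g j (e i) (0, \<lambda>v. coord i (h j v))) - (\<Sum>i\<in>Basis. g j (e (h j i)) (\<epsilon> i))) \<in> N"
    by (intro subgroup_add.sum_mem[OF N] naturality assms)
  then show ?thesis
    by (simp add: sum_subtractf)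
qed

lemma action_linear:
  "Vector_Spaces.linear sV sV (\<lambda>v. - l x v)"
  "Vector_Spaces.linear sV sV (\<lambda>v. signed s (r x v))"
  "Vector_Spaces.linear sV sV (\<lambda>v. - signed s (l x v))"
  "Vector_Spaces.linear sV sV (\<lambda>v. - r x v - signed s (l x v))"
  using V.vector_space_axioms
  by (auto simp: Vector_Spaces.linear_iff linear_simps signed_def V.scale_right_diff_distrib algebra_simps)

definition defect :: "'v \<Rightarrow> 'v \<Rightarrow> 'a"
  where "defect u v = p (T u) (T v) - T (l (T u) v + r (T v) u)"

definition double_sum :: "('v \<Rightarrow> 'v \<Rightarrow> 'g::ab_group_add) \<Rightarrow> 'g"
  where "double_sum c = (\<Sum>i\<in>Basis. \<Sum>j\<in>Basis. c i j)"

lemma double_sum_simps: "double_sum (\<lambda>i j. c i j + d i j) = double_sum c + double_sum d" "double_sum (\<lambda>i j. c i j - d i j) = double_sum c - double_sum d"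
  "double_sum (\<lambda>i j. - c i j) = - double_sum c" "double_sum (\<lambda>i j. signed s (c i j)) = signed s (double_sum c)"
  by (simp_all add: double_sum_def sum.distrib sum_subtractf sum_negf signed_sum)

lemma double_sum_swap: "double_sum (\<lambda>i j. c j i) = double_sum c"
  unfolding double_sum_def by (rule sum.swap)

text \<open>The formal sum that represents \<open>T - \<tau>(T)\<close>.\<close>

definition skew_tensor :: "('a \<times> ('v \<Rightarrow> 'k)) \<times> ('a \<times> ('v \<Rightarrow> 'k)) \<Rightarrow>\<^sub>0 int"
  where "skew_tensor = (\<Sum>b\<in>Basis. frag_of (e b, \<epsilon> b) - frag_of (\<epsilon> b, e b))"

lemma skew_tensor_polar:
  "yang_baxter_polar s hat_op skew_tensor skew_tensor = double_sum (\<lambda>i j.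
     yang_baxter_pair s hat_op (e i) (\<epsilon> i) (e j) (\<epsilon> j) - yang_baxter_pair s hat_op (e i) (\<epsilon> i) (\<epsilon> j) (e j)
     - yang_baxter_pair s hat_op (\<epsilon> i) (e i) (e j) (\<epsilon> j) + yang_baxter_pair s hat_op (\<epsilon> i) (e i) (\<epsilon> j) (e j))"
  by (simp add: yang_baxter_polar_def skew_tensor_def double_sum_def frag_extend_sum V.finite_Basis o_def
      frag_extend_diff sum_subtractf sum.distrib algebra_simps)

text \<open>The signs of the two actions are such that the third slot of the Yang-Baxter expression sees
  only the left action: the right actions cancel in the symmetrised or commutator products.\<close>

lemma hat_products:
  assumes "\<phi> \<in> dual" "\<psi> \<in> dual"
  shows "hat_op (a, 0) (b, 0) = (p a b, 0)"
    and "hat_op (0, \<phi>) (0, \<psi>) = 0"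
    and "hat_op (0, \<phi>) (a, 0) = (0, \<lambda>v. \<phi> (signed s (r a v)))"
    and "hat_op (a, 0) (0, \<phi>) = (0, \<lambda>v. \<phi> (- r a v - signed s (l a v)))"
    and "hat_op (0, \<phi>) (a, 0) + signed s (hat_op (a, 0) (0, \<phi>)) = (0, \<lambda>v. \<phi> (- l a v))"
    and "hat_op (a, 0) (0, \<phi>) + signed s (hat_op (0, \<phi>) (a, 0)) = (0, \<lambda>v. \<phi> (- signed s (l a v)))"
    and "hat_op (a, 0) (b, 0) + signed s (hat_op (b, 0) (a, 0)) = (p a b + signed s (p b a), 0)"
    and "hat_op (0, \<phi>) (0, \<psi>) + signed s (hat_op (0, \<psi>) (0, \<phi>)) = 0"
proof -
  have "\<phi> (u - v) = \<phi> u - \<phi> v" "\<phi> (- v) = - \<phi> v" for u v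
    using assms(1) dual_uminus[OF assms(1)] by (simp_all add: dual_iff flip: add_uminus_conv_diff)
  then show "hat_op (a, 0) (b, 0) = (p a b, 0)"
    and "hat_op (0, \<phi>) (0, \<psi>) = 0"
    and "hat_op (0, \<phi>) (a, 0) = (0, \<lambda>v. \<phi> (signed s (r a v)))"
    and "hat_op (a, 0) (0, \<phi>) = (0, \<lambda>v. \<phi> (- r a v - signed s (l a v)))"
    and "hat_op (0, \<phi>) (a, 0) + signed s (hat_op (a, 0) (0, \<phi>)) = (0, \<lambda>v. \<phi> (- l a v))"
    and "hat_op (a, 0) (0, \<phi>) + signed s (hat_op (0, \<phi>) (a, 0)) = (0, \<lambda>v. \<phi> (- signed s (l a v)))"
    and "hat_op (a, 0) (b, 0) + signed s (hat_op (b, 0) (a, 0)) = (p a b + signed s (p b a), 0)"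
    and "hat_op (0, \<phi>) (0, \<psi>) + signed s (hat_op (0, \<psi>) (0, \<phi>)) = 0"
    using dual_0[OF assms(1)] dual_0[OF assms(2)]
    by (auto simp: hat_product_Pair zero_simps signed_def fun_eq_iff zero_prod_def)
qed

abbreviation "defect_form i j \<equiv>
  signed s (frag_of (\<epsilon> i, \<epsilon> j, (defect i j + signed s (defect j i), 0 :: 'v \<Rightarrow> 'k)))
  - signed s (frag_of ((defect i j, 0), \<epsilon> i, \<epsilon> j)) - frag_of (\<epsilon> i, (defect i j, 0), \<epsilon> j)"

lemma additive_slot:
  "additive_mod hat.null3 (\<lambda>a. frag_of ((a, 0), \<epsilon> i, \<epsilon> j))"
  "additive_mod hat.null3 (\<lambda>a. frag_of (\<epsilon> i, (a, 0), \<epsilon> j))"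
  "additive_mod hat.null3 (\<lambda>a. frag_of (\<epsilon> i, \<epsilon> j, (a, 0)))"
  unfolding additive_mod_def
  using hat.balancedD(1)[OF hat.balanced_frag_of3(1)[of "\<epsilon> j"], of "(_, 0)" "\<epsilon> i" "(_, 0)"]
    hat.balancedD(1)[OF hat.balanced_frag_of3(3)[of "\<epsilon> i"], of "(_, 0)" "\<epsilon> j" "(_, 0)"]
    hat.balancedD(2)[OF hat.balanced_frag_of3(3)[of "\<epsilon> i"], of "\<epsilon> j" "(_, 0)" "(_, 0)"]
  by (simp_all add: hatB_mem)

text \<open>Six sums contain a functional \<open>i\<^sup>* \<circ> h\<close>. They are \<open>a1\<close> to \<open>a6\<close> below, and naturality turns them
  into \<open>b1\<close> to \<open>b6\<close>, where \<open>h\<close> acts on the argument of \<open>T\<close>. The sums with two factors from \<open>A\<close> multiplied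
  are \<open>q\<close>, \<open>q'\<close>, \<open>q''\<close>; those in \<open>z\<close> have a zero slot, from products of two functionals. Once the composed
  functionals are gone, the comparison with the defect holds summand by summand, by
  additivity in the slot that carries an element of \<open>A\<close>.\<close>

lemma yang_baxter_defect:
  "yang_baxter_polar s hat_op skew_tensor skew_tensor - double_sum defect_form \<in> hat.null3"
proof -
  interpret n: subgroup_add hat.null3 by (rule hat.subgroup_null3)
  note nat = naturality_double[OF hat.subgroup_null3, folded double_sum_def]
  let ?R = "\<lambda>j v. signed s (r (T j) v)" and ?L = "\<lambda>j v. - l (T j) v"
    and ?sL = "\<lambda>j v. - signed s (l (T j) v)" and ?M = "\<lambda>j v. - r (T j) v - signed s (l (T j) v)"
  note bal = hat.balanced_frag_of3 hat.balanced_swap[OF hat.subgroup_null3 hat.balanced_frag_of3(1)]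
      hat.balanced_swap[OF hat.subgroup_null3 hat.balanced_frag_of3(2)]
      hat.balanced_swap[OF hat.subgroup_null3 hat.balanced_frag_of3(3)]
  define q where "q = (\<lambda>i j. frag_of ((p (T i) (T j), 0 :: 'v \<Rightarrow> 'k), \<epsilon> i, \<epsilon> j))"
  define q' where "q' = (\<lambda>i j. frag_of (\<epsilon> i, (p (T i) (T j), 0 :: 'v \<Rightarrow> 'k), \<epsilon> j))"
  define q'' where "q'' = (\<lambda>i j. frag_of (\<epsilon> i, \<epsilon> j, (p (T i) (T j) + signed s (p (T j) (T i)), 0 :: 'v \<Rightarrow> 'k)))"
  define z where "z = (\<lambda>i j. signed s (frag_of (e i, e j, 0)) - frag_of (e i, 0, e j) - signed s (frag_of (0, e i, e j)))"
  define a1 where "a1 = (\<lambda>i j. frag_of (e i, (0 :: 'a, \<lambda>v. coord i (?R j v)), \<epsilon> j))"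
  define b1 where "b1 = (\<lambda>i j. frag_of (e (?R j i), \<epsilon> i, \<epsilon> j))"
  define a2 where "a2 = (\<lambda>i j. frag_of (e i, \<epsilon> j, (0 :: 'a, \<lambda>v. coord i (?L j v))))"
  define b2 where "b2 = (\<lambda>i j. frag_of (e (?L i j), \<epsilon> i, \<epsilon> j))"
  define a3 where "a3 = (\<lambda>i j. frag_of ((0 :: 'a, \<lambda>v. coord i (?R j v)), e i, \<epsilon> j))"
  define b3 where "b3 = (\<lambda>i j. frag_of (\<epsilon> i, e (?R j i), \<epsilon> j))"
  define a4 where "a4 = (\<lambda>i j. frag_of (\<epsilon> i, e j, (0 :: 'a, \<lambda>v. coord j (?sL i v))))"
  define b4 where "b4 = (\<lambda>i j. frag_of (\<epsilon> i, e (?sL i j), \<epsilon> j))"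
  define a5 where "a5 = (\<lambda>i j. frag_of ((0 :: 'a, \<lambda>v. coord j (?M i v)), \<epsilon> i, e j))"
  define b5 where "b5 = (\<lambda>i j. frag_of (\<epsilon> i, \<epsilon> j, e (?M j i)))"
  define a6 where "a6 = (\<lambda>i j. frag_of (\<epsilon> i, (0 :: 'a, \<lambda>v. coord j (?M i v)), e j))"
  define b6 where "b6 = (\<lambda>i j. frag_of (\<epsilon> i, \<epsilon> j, e (?M i j)))"
  \<comment> \<open>The summation indices are exchanged in the sums whose action depends on the inner index.\<close>
  have c1: "double_sum a1 - double_sum b1 \<in> hat.null3"
    using nat[of "\<lambda>j x y. frag_of (x, y, \<epsilon> j)" ?R]
    by (subst double_sum_swap[symmetric, of a1], subst double_sum_swap[symmetric, of b1])
      (simp add: a1_def b1_def bal hatB_mem action_linear)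
  have c2: "double_sum a2 - double_sum b2 \<in> hat.null3"
    using nat[of "\<lambda>j x y. frag_of (x, \<epsilon> j, y)" ?L]
    by (subst double_sum_swap[symmetric, of a2])
      (simp add: a2_def b2_def bal hatB_mem action_linear)
  have c3: "double_sum a3 - double_sum b3 \<in> hat.null3"
    using nat[of "\<lambda>j x y. frag_of (y, x, \<epsilon> j)" ?R]
    by (subst double_sum_swap[symmetric, of a3], subst double_sum_swap[symmetric, of b3])
      (simp add: a3_def b3_def bal hatB_mem action_linear)
  have c4: "double_sum a4 - double_sum b4 \<in> hat.null3"
    using nat[of "\<lambda>i x y. frag_of (\<epsilon> i, x, y)" ?sL]
    by (simp add: a4_def b4_def bal hatB_mem action_linear)
  have c5: "double_sum a5 - double_sum b5 \<in> hat.null3"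
    using nat[of "\<lambda>i x y. frag_of (y, \<epsilon> i, x)" ?M]
    by (subst double_sum_swap[symmetric, of b5])
      (simp add: a5_def b5_def bal hatB_mem action_linear)
  have c6: "double_sum a6 - double_sum b6 \<in> hat.null3"
    using nat[of "\<lambda>i x y. frag_of (\<epsilon> i, y, x)" ?M]
    by (simp add: a6_def b6_def bal hatB_mem action_linear)
  have zero: "z i j \<in> hat.null3" for i j
    unfolding z_def by (intro n.diff_mem n.signed_mem hat.frag_of_zero3 hatB_mem)
  define rest where "rest = (\<lambda>i j. b1 i j - signed s (q i j) - signed s (b2 i j)
      + signed s (b3 i j) - q' i j - signed s (b4 i j)
      + signed s (b5 i j) + b6 i j + signed s (q'' i j) + z i j - defect_form i j)"
  have rest: "rest i j \<in> hat.null3" for i j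
  proof -
    note P = n.additive_mod_pairs[OF additive_slot(1)[of i j]]
       n.additive_mod_pairs[OF additive_slot(2)[of i j]]
       n.additive_mod_pairs[OF additive_slot(3)[of i j]]
      n.additive_mod_triple[OF additive_slot(1)[of i j]]
       n.additive_mod_triple[OF additive_slot(3)[of i j]]
    \<comment> \<open>The slot of \<open>A\<close> is the first in 1, the second in 2 and the third in 3. Each claim is an identity
      of the form \<open>a + b = c + d\<close> or \<open>a + b + c = d\<close> in \<open>A\<close>, and which one depends on the sign.\<close>
    have 1: "b1 i j - signed s (q i j) - signed s (b2 i j) + signed s (frag_of ((defect i j, 0), \<epsilon> i, \<epsilon> j)) \<in> hat.null3"
    proof (cases s)
      case True
      then show ?thesis
        using P(1)[of "T (r (T j) i)" "defect i j" "p (T i) (T j)" "T (- l (T i) j)"]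
        by (simp add: b1_def b2_def q_def signed_def defect_def linear_simps uminus_simps algebra_simps)
    next
      case False
      then show ?thesis
        using P(4)[of "T (- r (T j) i)" "p (T i) (T j)" "T (- l (T i) j)" "defect i j"]
        by (simp add: b1_def b2_def q_def signed_def defect_def linear_simps uminus_simps algebra_simps)
    qed
    have 2: "signed s (b3 i j) - q' i j - signed s (b4 i j) + frag_of (\<epsilon> i, (defect i j, 0), \<epsilon> j) \<in> hat.null3"
    proof (cases s)
      case True
      then show ?thesis
        using P(2)[of "T (r (T j) i)" "defect i j" "p (T i) (T j)" "T (- l (T i) j)"]
        by (simp add: b3_def b4_def q'_def signed_def defect_def linear_simps uminus_simps algebra_simps)
    next
      case False
      then show ?thesis
        using P(2)[of "T (l (T i) j)" "defect i j" "T (- r (T j) i)" "p (T i) (T j)"]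
        by (simp add: b3_def b4_def q'_def signed_def defect_def linear_simps uminus_simps algebra_simps)
    qed
    have 3: "signed s (b5 i j) + b6 i j + signed s (q'' i j)
        - signed s (frag_of (\<epsilon> i, \<epsilon> j, (defect i j + signed s (defect j i), 0 :: 'v \<Rightarrow> 'k))) \<in> hat.null3"
    proof (cases s)
      case True
      then show ?thesis
        using P(5)[of "T (- r (T j) i - l (T j) i)" "T (- r (T i) j - l (T i) j)" "p (T i) (T j) + p (T j) (T i)" "defect i j + defect j i"]
        by (simp add: b5_def b6_def q''_def signed_def defect_def linear_simps uminus_simps algebra_simps)
    next
      case False
      then show ?thesis
        using P(3)[of "T (- r (T i) j + l (T i) j)" "defect i j - defect j i" "T (- r (T j) i + l (T j) i)" "p (T i) (T j) - p (T j) (T i)"]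
        by (simp add: b5_def b6_def q''_def signed_def defect_def linear_simps uminus_simps algebra_simps)
    qed
    from n.add_mem[OF n.add_mem[OF 1 2] n.add_mem[OF 3 zero[of i j]]]
    show ?thesis
      by (simp add: rest_def algebra_simps)
  qed
  have "yang_baxter_polar s hat_op skew_tensor skew_tensor = double_sum (\<lambda>i j. a1 i j - signed s (q i j) - signed s (a2 i j)
      + signed s (a3 i j) - q' i j - signed s (a4 i j)
      + signed s (a5 i j) + a6 i j + signed s (q'' i j) + z i j)"
    unfolding skew_tensor_polar
    by (intro arg_cong[of _ _ double_sum] ext,
        simp only: yang_baxter_pair_def hat_products(5-8)[OF coord_dual coord_dual],
        simp add: hat_products(1-4)[OF coord_dual coord_dual] a1_def a2_def a3_def a4_def a5_def a6_def
        q_def q'_def q''_def z_def)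
  then have "yang_baxter_polar s hat_op skew_tensor skew_tensor - double_sum defect_form =
     (double_sum a1 - double_sum b1) - signed s (double_sum a2 - double_sum b2) + signed s (double_sum a3 - double_sum b3) - signed s (double_sum a4 - double_sum b4)
     + signed s (double_sum a5 - double_sum b5) + (double_sum a6 - double_sum b6) + double_sum rest"
    by (cases s) (simp_all add: rest_def signed_def double_sum_simps algebra_simps)
  moreover have "double_sum rest \<in> hat.null3"
    unfolding double_sum_def by (intro n.sum_mem rest)
  ultimately show ?thesis
    using c1 c2 c3 c4 c5 c6 by (simp only: n.add_mem n.diff_mem n.signed_mem)
qed

end

section \<open>Recovering the defect\<close>

text \<open>Formal sums extend maps into arbitrary abelian groups, by the universal property of the free
  abelian group with the group of the type as target.\<close>

lemma additive_extension:
  fixes \<phi> :: "'c \<Rightarrow> 'd::ab_group_add"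
  obtains h where "\<And>s t. h (s - t) = h s - h t" "\<And>x. h (frag_of x) = \<phi> x"
proof -
  let ?G = "\<lparr>carrier = UNIV, monoid.mult = (+), one = 0\<rparr> :: 'd monoid"
  have "\<exists>y. y + x = 0 \<and> x + y = 0" for x :: 'd
    by (intro exI[of _ "- x"]) simp
  then have "comm_group ?G"
    by unfold_locales (auto simp: Units_def add_ac)
  then obtain h where h: "h \<in> hom (free_Abelian_group UNIV) ?G" "\<And>x. h (frag_of x) = \<phi> x"
    using comm_group.free_Abelian_group_universal[of ?G \<phi> UNIV] by auto
  have "h (s + t) = h s + h t" for s t
    using hom_mult[OF h(1), of s t] by simp
  then have "h (s - t) = h s - h t" for s t
    by (metis diff_add_cancel add_diff_cancel_right')
  then show ?thesis
    using h(2) that by blast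
qed

context signed_semidirect
begin

text \<open>Evaluating the last two slots at \<open>u\<close> and \<open>w\<close> is a trilinear map to \<open>A\<close>, hence defined on
  tensors.\<close>

lemma eval_null3:
  assumes h: "\<And>s t. h (s - t) = h s - h t"
    and eq: "\<And>a \<phi> b \<psi> c \<chi>. h (frag_of ((a, \<phi>), (b, \<psi>), (c, \<chi>))) = sA (\<psi> u * \<chi> w) a"
    and t: "t \<in> hat.null3"
  shows "h t = 0"
proof -
  have "h t \<in> {0}"
  proof (rule hat.additive_null3[OF t subgroup_add_zero h])
    fix z :: "'a \<times> ('v \<Rightarrow> 'k)" assume "z \<in> hatB"
    show "hat.balanced {0} (\<lambda>x y. h (frag_of (x, y, z)))" "hat.balanced {0} (\<lambda>x y. h (frag_of (z, x, y)))"
      by (cases z; auto simp: hat.balanced_def eq hat_scale_def A.scale_right_distrib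
         A.scale_left_distrib algebra_simps)+
  qed
  then show ?thesis by simp
qed

text \<open>The evaluation at \<open>b\<close>, \<open>c\<close> kills the terms of the normal form whose element of \<open>A\<close> sits in the
  second or third slot, since the functional component there is zero. Of the others it keeps the one with
  \<open>i = b\<close> and \<open>j = c\<close>.\<close>

lemma defect_zero_basis:
  assumes null: "yang_baxter_polar s hat_op skew_tensor skew_tensor \<in> hat.null3"
    and b: "b \<in> Basis" "c \<in> Basis"
  shows "defect b c = 0"
proof -
  obtain h :: "(('a \<times> ('v \<Rightarrow> 'k)) \<times> ('a \<times> ('v \<Rightarrow> 'k)) \<times> ('a \<times> ('v \<Rightarrow> 'k)) \<Rightarrow>\<^sub>0 int) \<Rightarrow> 'a"
    where h: "\<And>s t. h (s - t) = h s - h t"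
      and eq: "\<And>x. h (frag_of x) = (\<lambda>((a, \<phi>), (_, \<psi>), (_, \<chi>)). sA (\<psi> b * \<chi> c) a) x"
    by (rule additive_extension[of "\<lambda>((a, \<phi>), (_, \<psi>), (_, \<chi>)). sA (\<psi> b * \<chi> c) a"]) auto
  have h0: "h 0 = 0" using h[of 0 0] by simp
  then have hm: "h (- t) = - h t" for t using h[of 0 t] by simp
  have ha: "h (t + t') = h t + h t'" for t t' using h[of t "- t'"] by (simp add: hm)
  have hs: "h (sum t I) = (\<Sum>i\<in>I. h (t i))" for t and I :: "'v set"
    by (induction I rule: infinite_finite_induct) (simp_all add: h0 ha)
  have hsg: "h (signed s t) = signed s (h t)" for t by (simp add: signed_def hm)
  have "double_sum defect_form \<in> hat.null3"
    using null subgroup_add.mem_cong[OF hat.subgroup_null3 yang_baxter_defect] by simp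
  then have "h (double_sum defect_form) = 0"
    by (intro eval_null3[of h b c]) (simp_all add: h eq)
  then have "(\<Sum>i\<in>Basis. \<Sum>j\<in>Basis. sA (coord i b * coord j c) (defect i j)) = 0"
    by (simp add: double_sum_def hs ha h hsg eq signed_sum[symmetric] sum_negf)
      (cases s; simp add: signed_def sum_negf)
  moreover have "(\<Sum>i\<in>Basis. \<Sum>j\<in>Basis. sA (coord i b * coord j c) (defect i j)) = defect b c"
  proof -
    have "(\<Sum>j\<in>Basis. sA (coord i b * coord j c) (defect i j)) = sA (coord i b) (defect i c)" for i
      using b by (simp add: coord_delta if_distrib[of "\<lambda>x. sA x _"] sum.delta V.finite_Basis cong: if_cong)
    then show ?thesis
      using b by (simp add: coord_delta if_distrib[of "\<lambda>x. sA x _"] sum.delta V.finite_Basis cong: if_cong)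
  qed
  ultimately show ?thesis by simp
qed

lemma defect_linear:
  "Vector_Spaces.linear sV sA (\<lambda>u. defect u v)" "Vector_Spaces.linear sV sA (defect u)"
  using A.vector_space_axioms V.vector_space_axioms
  by (auto simp: Vector_Spaces.linear_iff defect_def linear_simps A.scale_right_diff_distrib
      A.scale_right_distrib algebra_simps)

lemma yang_baxter_iff_defect:
  "yang_baxter_polar s hat_op skew_tensor skew_tensor \<in> hat.null3 \<longleftrightarrow> (\<forall>u v. defect u v = 0)"
proof
  assume null: "yang_baxter_polar s hat_op skew_tensor skew_tensor \<in> hat.null3"
  show "\<forall>u v. defect u v = 0"
  proof (intro allI)
    fix u v
    have "defect u c = 0" if "c \<in> Basis" for c
      using linear_expand[OF defect_linear(1), of u c] defect_zero_basis[OF null _ that] by simp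
    then show "defect u v = 0"
      using linear_expand[OF defect_linear(2), of u v] by simp
  qed
next
  assume zero: "\<forall>u v. defect u v = 0"
  interpret n: subgroup_add hat.null3 by (rule hat.subgroup_null3)
  have "(0 :: 'a, 0 :: 'v \<Rightarrow> 'k) = 0" by (simp add: zero_prod_def)
  then have "double_sum defect_form \<in> hat.null3"
    using zero unfolding double_sum_def
    by (auto intro!: n.sum_mem n.add_mem n.diff_mem n.signed_mem hat.frag_of_zero3 hatB_mem
        simp: signed_def)
  then show "yang_baxter_polar s hat_op skew_tensor skew_tensor \<in> hat.null3"
    using n.mem_cong[OF yang_baxter_defect] by simp
qed

section \<open>Skew-symmetric solutions and O-operators\<close>

lemma skew_tensor_keys: "Poly_Mapping.keys skew_tensor \<subseteq> hatB \<times> hatB"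
proof -
  have "Poly_Mapping.keys (\<Sum>b\<in>I. frag_of (e b, \<epsilon> b) - frag_of (\<epsilon> b, e b)) \<subseteq> hatB \<times> hatB" for I
    unfolding carrier_free_Abelian_group_iff[symmetric]
    by (intro sum_closed_free_Abelian_group)
      (simp only: carrier_free_Abelian_group_iff, intro keys_diff_subset, simp_all add: hatB_mem)
  then show ?thesis
    by (simp add: skew_tensor_def)
qed

lemma skew_map_tensor_eq:
  "skew_map_tensor sA sV Basis T = tensor2_class (hat_scale sA) hatB skew_tensor"
proof -
  let ?t = "\<Sum>b\<in>Basis. frag_of (e b, \<epsilon> b)"
  have k: "Poly_Mapping.keys ?t \<subseteq> hatB \<times> hatB" "Poly_Mapping.keys (frag_flip ?t) \<subseteq> hatB \<times> hatB"
    unfolding carrier_free_Abelian_group_iff[symmetric]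
    by (auto intro!: sum_closed_free_Abelian_group simp: frag_extend_sum V.finite_Basis hatB_mem
        simp del: carrier_free_Abelian_group_iff)
  have "map_tensor sA sV Basis T = tensor2_class (hat_scale sA) hatB ?t"
    by (simp add: map_tensor_def coord_def)
  moreover have "?t + - frag_flip ?t = skew_tensor"
    by (simp add: skew_tensor_def frag_extend_sum V.finite_Basis sum_subtractf)
  ultimately show ?thesis
    using k by (simp add: skew_map_tensor_def Let_def hat.tensor_flip_class hat.tensor2_class_inv
      hat.tensor2_class_add)
qed

lemma frag_flip_graph_tensor: "frag_flip skew_tensor = - skew_tensor"
  by (simp add: skew_tensor_def frag_extend_sum V.finite_Basis o_def frag_extend_diff flip: sum_negf)

text \<open>Skew-symmetry is automatic, because the flip negates the representing sum; the equivalence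
  rests on the two equations.\<close>

lemma skew_symmetric_skew_map_tensor:
  "skew_symmetric_tensor (hat_scale sA) hatB (skew_map_tensor sA sV Basis T)"
  using skew_tensor_keys
  by (simp add: skew_symmetric_tensor_def skew_map_tensor_eq hat.tensor_flip_class
      hat.tensor2_class_inv frag_flip_graph_tensor)

lemma skew_map_tensor_carrier:
  "skew_map_tensor sA sV Basis T \<in> carrier (tensor2 (hat_scale sA) hatB)"
  by (simp add: skew_map_tensor_eq hat.tensor2_class_carrier skew_tensor_keys)

lemma yang_baxter_skew_map_tensor:
  "(\<Union>t\<in>skew_map_tensor sA sV Basis T. tensor3_class (hat_scale sA) hatB (yang_baxter_polar s hat_op t t))
      = \<one>\<^bsub>tensor3 (hat_scale sA) hatB\<^esub>
    \<longleftrightarrow> (\<forall>u v. p (T u) (T v) = T (l (T u) v + r (T v) u))"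
  unfolding skew_map_tensor_eq hat.Union_yang_baxter_class[OF skew_tensor_keys] yang_baxter_iff_defect
  by (simp add: defect_def)

end

lemma (in bilinear_algebra) linear_mult:
  assumes "B = UNIV"
  shows "Vector_Spaces.linear scale scale (\<lambda>x. mult x y)" "Vector_Spaces.linear scale scale (\<lambda>y. mult x y)"
  using vector_space_axioms
  by (simp_all add: Vector_Spaces.linear_iff assms mult_add_left mult_add_right mult_scale_left mult_scale_right)

theorem theorem3p32:
  fixes sA :: "'k::field \<Rightarrow> 'a::ab_group_add \<Rightarrow> 'a"
    and ast circ :: "'a \<Rightarrow> 'a \<Rightarrow> 'a"
    and sV :: "'k \<Rightarrow> 'v::ab_group_add \<Rightarrow> 'v"
    and Basis :: "'v set"
    and la ra lc rc :: "'a \<Rightarrow> 'v \<Rightarrow> 'v"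
    and T :: "'v \<Rightarrow> 'a"
  assumes "anti_pre_Poisson_algebra sA UNIV ast circ"
    and "finite_dimensional_vector_space sV Basis"
    and "anti_pre_Poisson_representation sA ast circ sV Basis la ra lc rc"
    and "Vector_Spaces.linear sV sA T"
  shows "skew_symmetric_tensor (hat_scale sA) (hat_carrier sV) (skew_map_tensor sA sV Basis T) \<and>
      APP_YBE_solution (hat_scale sA) (hat_carrier sV) (hat_ast ast la ra) (hat_circ circ lc rc)
        (skew_map_tensor sA sV Basis T)
    \<longleftrightarrow> O_operator sA ast circ sV la ra lc rc T"
proof -
  interpret R: anti_pre_Poisson_representation sA ast circ sV Basis la ra lc rc
    by (rule assms(3))
  have "bilinear_algebra sA UNIV ast" "bilinear_algebra sA UNIV circ"
    by unfold_locales
  note linear = this[THEN bilinear_algebra.linear_mult(1), OF refl]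
    this[THEN bilinear_algebra.linear_mult(2), OF refl]
  interpret ast: signed_semidirect sA sV Basis True ast la ra T
    by (intro signed_semidirect.intro signed_semidirect_axioms.intro
        R.vector_space_axioms linear R.linear_actions assms)
  interpret circ: signed_semidirect sA sV Basis False circ lc rc T
    by (intro signed_semidirect.intro signed_semidirect_axioms.intro
        R.vector_space_axioms linear R.linear_actions assms)
  have "D_tensor (hat_scale sA) (hat_carrier sV) (hat_ast ast la ra) (skew_map_tensor sA sV Basis T)
      = \<one>\<^bsub>tensor3 (hat_scale sA) (hat_carrier sV)\<^esub>
      \<longleftrightarrow> (\<forall>u v. ast (T u) (T v) = T (la (T u) v + ra (T v) u))"
    by (simp only: D_tensor_def D_formal_eq hat_ast_eq ast.yang_baxter_skew_map_tensor)
  moreover have "S_tensor (hat_scale sA) (hat_carrier sV) (hat_circ circ lc rc) (skew_map_tensor sA sV Basis T)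
      = \<one>\<^bsub>tensor3 (hat_scale sA) (hat_carrier sV)\<^esub>
      \<longleftrightarrow> (\<forall>u v. circ (T u) (T v) = T (lc (T u) v + rc (T v) u))"
    by (simp only: S_tensor_def S_formal_eq hat_circ_eq circ.yang_baxter_skew_map_tensor)
  ultimately show ?thesis
    by (simp add: O_operator_def APP_YBE_solution_def assms(4) ast.skew_symmetric_skew_map_tensor
        ast.skew_map_tensor_carrier)
qed

end
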